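(* Assume $\sup_{1\le i\le p}E\rho_i^{1/2}(X_{(i)},0_{d_i})<\infty$ and $\sup_{1\le i\le p}E\rho_i^{1/2}(Y_{(i)},0_{d_i})<\infty$. Then, in either Case S1 or Case S2, $\mathcal E(X,Y)=0$ if and only if $X\overset{d}{=}Y$; in other words, $\mathcal E(X,Y)$ completely characterizes the homogeneity of the distributions of $X$ and $Y$.
   Context: $X=(X_{(1)},\dots,X_{(p)})$ and $Y=(Y_{(1)},\dots,Y_{(p)})$ are independent random vectors in $\mathbb R^{\tilde p}$, $\tilde p=\sum_{i=1}^pd_i$, with groups $X_{(i)},Y_{(i)}\in\mathbb R^{d_i}$; $(X',Y')$ is an independent copy of $(X,Y)$; $0_{d}$ is the origin of $\mathbb R^d$. $K(x,x')=\sqrt{\sum_{i=1}^p\rho_i(x_{(i)},x'_{(i)})}$. Case S1: each $\rho_i$ is a metric of strong negative type on $\mathbb R^{d_i}$. Case S2: $\rho_i(x_{(i)},x'_{(i)})=\|x_{(i)}-x'_{(i)}\|^2$ for each $i$ (so $K$ is the Euclidean distance). A metric space $(\mathcal X,d)$ has negative type if for all $n\ge1$, $x_1,\dots,x_n\in\mathcal X$ and $\alpha_1,\dots,\alpha_n\in\mathbb R$ with $\sum_i\alpha_i=0$ one has $\sum_{i,j=1}^n\alpha_i\alpha_jd(x_i,x_j)\le0$; it has strong negative type if moreover (for distinct points $x_1,\dots,x_n$) equality holds only when $\alpha_i=0$ for all $i$. $\mathcal E(X,Y)=2E K(X,Y)-E K(X,X')-E K(Y,Y')$.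
   Formalization: In Case S1 each metric ρ_i is also assumed separable with Borel sets equal to the usual Borel sets of R^{d_i}; without this the claim fails, e.g. for the discrete metric on R, where any two atomless laws have energy distance 0. *)

theory Defs
  imports "HOL-Probability.Probability"
begin

text \<open>
  The dimensions of the groups are natural numbers that vary with the group, so a vector of
  \<open>R^n\<close> is an extensional function on \<open>{1..n}\<close>, and a vector \<open>x\<close> consisting of \<open>p\<close> groups is an
  extensional function on \<open>{1..p}\<close> whose value \<open>x i\<close> is the \<open>i\<close>-th group. The product sigma-algebras
  below are the usual Borel sigma-algebras of these finite-dimensional spaces.
\<close>

definition eucl_space :: "nat \<Rightarrow> (nat \<Rightarrow> real) set" where
  "eucl_space n = {1..n} \<rightarrow>\<^sub>E UNIV"

definition eucl_borel :: "nat \<Rightarrow> (nat \<Rightarrow> real) measure" where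
  "eucl_borel n = Pi\<^sub>M {1..n} (\<lambda>_. borel)"

definition eucl_origin :: "nat \<Rightarrow> nat \<Rightarrow> real" where
  "eucl_origin n = (\<lambda>j\<in>{1..n}. 0)"

definition eucl_dist :: "nat \<Rightarrow> (nat \<Rightarrow> real) \<Rightarrow> (nat \<Rightarrow> real) \<Rightarrow> real" where
  "eucl_dist n x y = L2_set (\<lambda>j. x j - y j) {1..n}"

definition grouped_borel :: "nat \<Rightarrow> (nat \<Rightarrow> nat) \<Rightarrow> (nat \<Rightarrow> nat \<Rightarrow> real) measure" where
  "grouped_borel p d = Pi\<^sub>M {1..p} (\<lambda>i. eucl_borel (d i))"

definition negative_type :: "'a set \<Rightarrow> ('a \<Rightarrow> 'a \<Rightarrow> real) \<Rightarrow> bool" where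
  "negative_type S \<delta> \<longleftrightarrow>
     Metric_space S \<delta> \<and>
     (\<forall>n\<ge>1. \<forall>(x :: nat \<Rightarrow> 'a) (\<alpha> :: nat \<Rightarrow> real).
        x ` {1..n} \<subseteq> S \<longrightarrow> (\<Sum>i=1..n. \<alpha> i) = 0 \<longrightarrow>
        (\<Sum>i=1..n. \<Sum>j=1..n. \<alpha> i * \<alpha> j * \<delta> (x i) (x j)) \<le> 0)"

definition strong_negative_type :: "'a set \<Rightarrow> ('a \<Rightarrow> 'a \<Rightarrow> real) \<Rightarrow> bool" where
  "strong_negative_type S \<delta> \<longleftrightarrow>
     negative_type S \<delta> \<and>
     (\<forall>n\<ge>1. \<forall>(x :: nat \<Rightarrow> 'a) (\<alpha> :: nat \<Rightarrow> real).
        x ` {1..n} \<subseteq> S \<longrightarrow> inj_on x {1..n} \<longrightarrow> (\<Sum>i=1..n. \<alpha> i) = 0 \<longrightarrow>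
        (\<Sum>i=1..n. \<Sum>j=1..n. \<alpha> i * \<alpha> j * \<delta> (x i) (x j)) = 0 \<longrightarrow>
        (\<forall>i\<in>{1..n}. \<alpha> i = 0))"

text \<open>
  A random vector is to be a random element of the metric space \<open>(R^n, \<delta>)\<close>, whose metric need not
  induce the Euclidean topology. Some compatibility of this kind cannot be dispensed with: the
  discrete metric on the real line is of strong negative type in the above sense and jointly Borel
  measurable, but it gives the energy distance 0 to any two atomless distributions. (If all open
  sets of the metric are Borel sets, then separability and equality of the two sigma-algebras
  already follow, by the perfect set property of Borel sets and the Lusin-Souslin theorem.)
\<close>

definition borel_compatible :: "nat \<Rightarrow> ((nat \<Rightarrow> real) \<Rightarrow> (nat \<Rightarrow> real) \<Rightarrow> real) \<Rightarrow> bool" where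
  "borel_compatible n \<delta> \<longleftrightarrow>
     separable_space (Metric_space.mtopology (eucl_space n) \<delta>) \<and>
     sigma_sets (eucl_space n) {U. openin (Metric_space.mtopology (eucl_space n) \<delta>) U}
       = sets (eucl_borel n)"

definition group_metric ::
    "nat \<Rightarrow> (nat \<Rightarrow> 'a \<Rightarrow> 'a \<Rightarrow> real) \<Rightarrow> (nat \<Rightarrow> 'a) \<Rightarrow> (nat \<Rightarrow> 'a) \<Rightarrow> real" where
  "group_metric p \<rho> x y = sqrt (\<Sum>i=1..p. \<rho> i (x i) (y i))"

text \<open>Here \<open>(X', Y')\<close> is meant to be an independent copy of \<open>(X, Y)\<close>.\<close>

definition energy_distance ::
    "'w measure \<Rightarrow> ('a \<Rightarrow> 'a \<Rightarrow> real) \<Rightarrow> ('w \<Rightarrow> 'a) \<Rightarrow> ('w \<Rightarrow> 'a) \<Rightarrow> ('w \<Rightarrow> 'a) \<Rightarrow> ('w \<Rightarrow> 'a) \<Rightarrow> real" where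
  "energy_distance M K X Y X' Y' =
     2 * (\<integral>\<omega>. K (X \<omega>) (Y \<omega>) \<partial>M) - (\<integral>\<omega>. K (X \<omega>) (X' \<omega>) \<partial>M) - (\<integral>\<omega>. K (Y \<omega>) (Y' \<omega>) \<partial>M)"

end

theory Submission
  imports Defs
begin

text \<open>
  The kernel \<open>D x y = (\<Sum>i. \<rho> i (x i) (y i))\<close> is conditionally negative definite, so every \<open>exp (- t D)\<close>
  with \<open>t > 0\<close> is positive definite (Schoenberg). Since \<open>sqrt D\<close> is a constant multiple of
  \<open>\<integral> (1 - exp (- s\<^sup>2 D)) / s\<^sup>2 ds\<close>, the energy distance is a mixture over \<open>s\<close> of the nonnegative energies
  of \<open>P - Q\<close> with respect to \<open>exp (- s\<^sup>2 D)\<close>; if it vanishes, all of these vanish. The energy for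
  \<open>s\<^sup>2 = m\<close> bounds the square of the integral of \<open>exp (- m |x - w|\<^sup>2)\<close> against \<open>P - Q\<close>, where \<open>w\<close> is the
  barycentre, in a Hilbert space in which \<open>D\<close> is the squared distance, of any \<open>m\<close> points \<open>y 1, \<dots>, y m\<close>.
  Up to a constant factor this function is \<open>\<Prod>l. exp (- D x (y l))\<close>. So \<open>P\<close> and \<open>Q\<close> integrate
  all products of the functions \<open>exp (- D \<cdot> y)\<close> alike, hence agree on finite intersections of \<open>D\<close>-balls,
  and these generate the sigma-algebra.
\<close>

subsection \<open>Exponentials of positive semidefinite matrices\<close>

text \<open>Injectivity has to come from the square root. The energy of P - Q with respect to
  \<open>D\<close> itself forgets too much: for the squared Euclidean distance and finite second
  moments it is twice the squared distance of the two means. Under the root all scales s are present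
  at once, and this is what allows m to vary: a product over m points is controlled at the scale
  sqrt m. These scales form a null set, so vanishing for almost every s has to be upgraded by
  continuity in s.

  No Hilbert space is constructed. The barycentre w need not be a point of the given space, so
  everything is phrased through finite quadratic forms in values of \<open>D\<close>. The link is
  Huygens' identity: the sum of \<open>D x (y l)\<close> over l is m times the squared distance from
  x to w, plus a constant V that is independent of x and nonnegative.\<close>

lemma quadratic_form_insert:
  fixes A :: "'i \<Rightarrow> 'i \<Rightarrow> real"
  assumes "finite I" "k \<notin> I" "\<And>i j. i \<in> insert k I \<Longrightarrow> j \<in> insert k I \<Longrightarrow> A i j = A j i"
  shows "(\<Sum>i\<in>insert k I. \<Sum>j\<in>insert k I. c i * c j * A i j) =
    (c k)\<^sup>2 * A k k + 2 * c k * (\<Sum>i\<in>I. c i * A k i) + (\<Sum>i\<in>I. \<Sum>j\<in>I. c i * c j * A i j)"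
proof -
  have "(\<Sum>i\<in>I. c i * c k * A i k) = c k * (\<Sum>i\<in>I. c i * A k i)"
    using assms(3) by (auto simp: sum_distrib_left intro!: sum.cong)
  moreover have "(\<Sum>i\<in>I. c k * c i * A k i) = c k * (\<Sum>i\<in>I. c i * A k i)"
    by (auto simp: sum_distrib_left intro!: sum.cong)
  ultimately show ?thesis
    using assms(1,2) by (simp add: sum.distrib power2_eq_square)
qed

text \<open>Cholesky factorization: the pivot \<open>k\<close> is split off and the Schur complement
  \<open>A'\<close> is factorized by induction. The matrix is only semidefinite, so the pivot may be
  0; division by zero then gives \<open>A' = A\<close> on \<open>I\<close>, and \<open>zero\<close>
  shows that the pivot row vanishes.\<close>

lemma psd_factorization:
  fixes A :: "'i \<Rightarrow> 'i \<Rightarrow> real"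
  assumes "finite I" "\<And>i j. i \<in> I \<Longrightarrow> j \<in> I \<Longrightarrow> A i j = A j i"
    and "\<And>c. 0 \<le> (\<Sum>i\<in>I. \<Sum>j\<in>I. c i * c j * A i j)"
  shows "\<exists>v :: 'i \<Rightarrow> 'i \<Rightarrow> real. \<forall>i\<in>I. \<forall>j\<in>I. A i j = (\<Sum>k\<in>I. v k i * v k j)"
  using assms
proof (induction I arbitrary: A rule: finite_induct)
  case empty
  then show ?case by simp
next
  case (insert k I)
  have form: "(\<Sum>i\<in>insert k I. \<Sum>j\<in>insert k I. c i * c j * A i j) =
    (c k)\<^sup>2 * A k k + 2 * c k * (\<Sum>i\<in>I. c i * A k i) + (\<Sum>i\<in>I. \<Sum>j\<in>I. c i * c j * A i j)" for c
    using insert.hyps insert.prems(1) by (intro quadratic_form_insert) auto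
  define A' where "A' i j = A i j - A k i * A k j / A k k" for i j
  have Akk: "A k k \<ge> 0"
  proof -
    define e :: "'i \<Rightarrow> real" where "e i = (if i = k then 1 else 0)" for i
    have "(\<Sum>i\<in>I. e i * A k i) = 0" "(\<Sum>i\<in>I. \<Sum>j\<in>I. e i * e j * A i j) = 0"
      using insert.hyps by (auto simp: e_def intro!: sum.neutral)
    then show ?thesis
      using insert.prems(2)[of e] form[of e] by (simp add: e_def[of k])
  qed
  have "\<exists>v :: 'i \<Rightarrow> 'i \<Rightarrow> real. \<forall>i\<in>I. \<forall>j\<in>I. A' i j = (\<Sum>k\<in>I. v k i * v k j)"
  proof (rule insert.IH)
    show "A' i j = A' j i" if "i \<in> I" "j \<in> I" for i j
      using insert.prems(1)[of i j] that by (simp add: A'_def mult.commute)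
    fix c :: "'i \<Rightarrow> real"
    let ?S = "\<Sum>i\<in>I. c i * A k i"
    \<comment> \<open>For a positive pivot this value of the \<open>k\<close>-th coordinate
      minimizes the form, and the minimum is the form of the Schur complement. For a zero pivot it
      is 0.\<close>
    define c' where "c' = c(k := - ?S / A k k)"
    have 1: "(\<Sum>i\<in>I. c' i * A k i) = ?S"
      using insert.hyps by (intro sum.cong) (auto simp: c'_def)
    have 2: "(\<Sum>i\<in>I. \<Sum>j\<in>I. c' i * c' j * A i j) = (\<Sum>i\<in>I. \<Sum>j\<in>I. c i * c j * A i j)"
      using insert.hyps by (intro sum.cong refl) (auto simp: c'_def)
    have 3: "(\<Sum>i\<in>I. \<Sum>j\<in>I. c i * c j * A' i j) =
        (\<Sum>i\<in>I. \<Sum>j\<in>I. c i * c j * A i j) - ?S * ?S / A k k"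
      by (simp add: A'_def sum_subtractf right_diff_distrib sum_product sum_divide_distrib mult_ac)
    have "0 \<le> (c' k)\<^sup>2 * A k k + 2 * c' k * ?S + (\<Sum>i\<in>I. \<Sum>j\<in>I. c i * c j * A i j)"
      using insert.prems(2)[of c'] unfolding form 1 2 .
    also have "(c' k)\<^sup>2 * A k k + 2 * c' k * ?S = - ?S * ?S / A k k"
      by (cases "A k k = 0") (simp_all add: c'_def power2_eq_square field_simps)
    finally show "0 \<le> (\<Sum>i\<in>I. \<Sum>j\<in>I. c i * c j * A' i j)"
      unfolding 3 by simp
  qed
  then obtain v where v: "\<And>i j. i \<in> I \<Longrightarrow> j \<in> I \<Longrightarrow> A' i j = (\<Sum>k\<in>I. v k i * v k j)"
    by blast
  have zero: "A k i = 0" if i: "i \<in> I" and 0: "A k k = 0" for i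
  proof (rule ccontr)
    assume "A k i \<noteq> 0"
    \<comment> \<open>With a zero pivot the form is affine in \<open>c k\<close>; the coefficient is
      chosen so that the form takes the value -1.\<close>
    define c where "c j = (if j = k then - (A i i + 1) / (2 * A k i) else if j = i then 1 else 0)" for j
    have "(\<Sum>j\<in>I. c j * A k j) = (\<Sum>j\<in>I. if j = i then A k j else 0)"
      using insert.hyps by (intro sum.cong) (auto simp: c_def)
    also have "\<dots> = A k i" using insert.hyps i by simp
    finally have 1: "(\<Sum>j\<in>I. c j * A k j) = A k i" .
    have "c j * c l * A j l = (if j = i then if l = i then A j l else 0 else 0)"
      if "j \<in> I" "l \<in> I" for j l
      using insert.hyps that by (auto simp: c_def)
    then have "(\<Sum>j\<in>I. \<Sum>l\<in>I. c j * c l * A j l) =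
        (\<Sum>j\<in>I. if j = i then \<Sum>l\<in>I. if l = i then A j l else 0 else 0)"
      by (intro sum.cong) auto
    also have "\<dots> = A i i" using insert.hyps i by simp
    finally have "0 \<le> 2 * c k * A k i + A i i"
      using insert.prems(2)[of c] unfolding form 1 by (simp add: 0)
    moreover have "2 * c k * A k i = - (A i i + 1)"
      using \<open>A k i \<noteq> 0\<close> by (simp add: c_def)
    ultimately show False by linarith
  qed
  \<comment> \<open>The old vectors are extended by 0 at \<open>k\<close>, and the new vector, the
    scaled pivot row, restores what the Schur complement subtracted.\<close>
  define w where "w l i = (if l = k then A k i / sqrt (A k k) else if i = k then 0 else v l i)" for l i
  have w: "(\<Sum>l\<in>insert k I. w l i * w l j) =
      A k i * A k j / A k k + (if i = k \<or> j = k then 0 else \<Sum>l\<in>I. v l i * v l j)" for i j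
  proof -
    have "(\<Sum>l\<in>I. w l i * w l j) = (if i = k \<or> j = k then 0 else \<Sum>l\<in>I. v l i * v l j)"
      using insert.hyps by (auto simp: w_def intro!: sum.cong sum.neutral)
    moreover have "w k i * w k j = A k i * A k j / A k k"
      using Akk by (simp add: w_def)
    ultimately show ?thesis using insert.hyps by simp
  qed
  show ?case
  proof (intro exI ballI)
    fix i j assume ij: "i \<in> insert k I" "j \<in> insert k I"
    show "A i j = (\<Sum>l\<in>insert k I. w l i * w l j)"
      using ij zero insert.prems(1)[of i k] v[of i j] unfolding w
      by (cases "A k k = 0") (auto simp: A'_def)
  qed
qed

text \<open>A factorization writes \<open>A\<close> as a sum of rank-one matrices, and multiplying
  \<open>C\<close> entrywise by a rank-one matrix only rescales the test vector to
  \<open>c i * v k i\<close>.\<close>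

lemma psd_Schur_product:
  fixes A C :: "'i \<Rightarrow> 'i \<Rightarrow> real"
  assumes "finite I" "\<And>i j. i \<in> I \<Longrightarrow> j \<in> I \<Longrightarrow> A i j = A j i"
    and "\<And>c. 0 \<le> (\<Sum>i\<in>I. \<Sum>j\<in>I. c i * c j * A i j)"
    and C: "\<And>c. 0 \<le> (\<Sum>i\<in>I. \<Sum>j\<in>I. c i * c j * C i j)"
  shows "0 \<le> (\<Sum>i\<in>I. \<Sum>j\<in>I. c i * c j * (A i j * C i j))"
proof -
  obtain v :: "'i \<Rightarrow> 'i \<Rightarrow> real" where v: "\<And>i j. i \<in> I \<Longrightarrow> j \<in> I \<Longrightarrow> A i j = (\<Sum>k\<in>I. v k i * v k j)"
    using psd_factorization[of I A] assms(1-3) by blast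
  have "(\<Sum>i\<in>I. \<Sum>j\<in>I. c i * c j * (A i j * C i j)) =
      (\<Sum>i\<in>I. \<Sum>j\<in>I. \<Sum>k\<in>I. (c i * v k i) * (c j * v k j) * C i j)"
    by (intro sum.cong refl) (auto simp: v sum_distrib_left sum_distrib_right mult_ac)
  also have "\<dots> = (\<Sum>i\<in>I. \<Sum>k\<in>I. \<Sum>j\<in>I. (c i * v k i) * (c j * v k j) * C i j)"
    by (intro sum.cong refl sum.swap)
  also have "\<dots> = (\<Sum>k\<in>I. \<Sum>i\<in>I. \<Sum>j\<in>I. (c i * v k i) * (c j * v k j) * C i j)"
    by (rule sum.swap)
  also have "\<dots> \<ge> 0"
    by (intro sum_nonneg C[of "\<lambda>i. c i * v k i" for k])
  finally show ?thesis .
qed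

text \<open>All entrywise powers are positive semidefinite by the Schur product. The zeroth power is
  the all-ones matrix, whose form is the square on the left; keeping this term, rather than bounding
  the series by 0, is what later yields information on single integrals.\<close>

lemma psd_exp_ge:
  fixes A :: "'i \<Rightarrow> 'i \<Rightarrow> real"
  assumes "finite I" and sym: "\<And>i j. i \<in> I \<Longrightarrow> j \<in> I \<Longrightarrow> A i j = A j i"
    and psd: "\<And>c. 0 \<le> (\<Sum>i\<in>I. \<Sum>j\<in>I. c i * c j * A i j)"
  shows "(\<Sum>i\<in>I. c i)\<^sup>2 \<le> (\<Sum>i\<in>I. \<Sum>j\<in>I. c i * c j * exp (A i j))"
proof -
  have pow: "0 \<le> (\<Sum>i\<in>I. \<Sum>j\<in>I. c i * c j * A i j ^ n)" for n and c :: "'i \<Rightarrow> real"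
  proof (induction n arbitrary: c)
    case 0
    have "(\<Sum>i\<in>I. \<Sum>j\<in>I. c i * c j * A i j ^ 0) = (\<Sum>i\<in>I. c i) * (\<Sum>i\<in>I. c i)"
      by (simp add: sum_product)
    then show ?case by simp
  next
    case (Suc n)
    show ?case
      using psd_Schur_product[OF \<open>finite I\<close> sym psd Suc.IH, of c] by simp
  qed
  have "(\<lambda>n. A i j ^ n / fact n) sums exp (A i j)" for i j
    using exp_converges[of "A i j"] by (simp add: field_simps)
  then have "(\<lambda>n. \<Sum>i\<in>I. \<Sum>j\<in>I. c i * c j * (A i j ^ n / fact n)) sums
      (\<Sum>i\<in>I. \<Sum>j\<in>I. c i * c j * exp (A i j))"
    by (intro sums_sum sums_mult)
  then have sums: "(\<lambda>n. (\<Sum>i\<in>I. \<Sum>j\<in>I. c i * c j * A i j ^ n) / fact n) sums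
      (\<Sum>i\<in>I. \<Sum>j\<in>I. c i * c j * exp (A i j))"
    by (simp add: sum_divide_distrib)
  have "(\<Sum>n<1. (\<Sum>i\<in>I. \<Sum>j\<in>I. c i * c j * A i j ^ n) / fact n) \<le>
      (\<Sum>n. (\<Sum>i\<in>I. \<Sum>j\<in>I. c i * c j * A i j ^ n) / fact n)"
    using sums by (intro sum_le_suminf sums_summable) (auto intro: divide_nonneg_pos pow)
  then show ?thesis
    by (simp add: sums_unique[OF sums, symmetric] power2_eq_square sum_product)
qed

subsection \<open>Conditionally negative kernels\<close>

text \<open>The inequality of \<open>negative_type\<close> without the metric axioms, so that
  squared Euclidean distances and sums over groups qualify as well.\<close>

definition conditionally_negative :: "'a set \<Rightarrow> ('a \<Rightarrow> 'a \<Rightarrow> real) \<Rightarrow> bool" where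
  "conditionally_negative S \<delta> \<longleftrightarrow>
     (\<forall>n\<ge>1. \<forall>(x :: nat \<Rightarrow> 'a) (\<alpha> :: nat \<Rightarrow> real).
        x ` {1..n} \<subseteq> S \<longrightarrow> (\<Sum>i=1..n. \<alpha> i) = 0 \<longrightarrow>
        (\<Sum>i=1..n. \<Sum>j=1..n. \<alpha> i * \<alpha> j * \<delta> (x i) (x j)) \<le> 0)"

text \<open>Reindexing to arbitrary finite index sets, in particular to disjoint sums that merge two
  families of points.\<close>

lemma conditionally_negativeD:
  assumes \<delta>: "conditionally_negative S \<delta>" and "finite I" "x ` I \<subseteq> S" "(\<Sum>i\<in>I. c i) = 0"
  shows "(\<Sum>i\<in>I. \<Sum>j\<in>I. c i * c j * \<delta> (x i) (x j)) \<le> 0"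
proof (cases "I = {}")
  case False
  from ex_bij_betw_nat_finite_1[OF \<open>finite I\<close>] obtain h where h: "bij_betw h {1..card I} I"
    by blast
  have "(\<Sum>i\<in>I. \<Sum>j\<in>I. c i * c j * \<delta> (x i) (x j)) =
      (\<Sum>i=1..card I. \<Sum>j=1..card I. c (h i) * c (h j) * \<delta> (x (h i)) (x (h j)))"
    by (simp add: sum.reindex_bij_betw[OF h, symmetric])
  also have "\<dots> \<le> 0"
  proof -
    have "card I \<ge> 1" using False \<open>finite I\<close> by (simp add: Suc_le_eq card_gt_0_iff)
    moreover have "(x \<circ> h) ` {1..card I} \<subseteq> S"
      using assms(3) h by (auto simp: bij_betw_def)
    moreover have "(\<Sum>i=1..card I. (c \<circ> h) i) = 0"
      unfolding o_def sum.reindex_bij_betw[OF h] by (rule assms(4))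
    ultimately show ?thesis
      using \<delta>[unfolded conditionally_negative_def, rule_format, of "card I" "x \<circ> h" "c \<circ> h"] by simp
  qed
  finally show ?thesis .
qed simp

text \<open>In terms of reproducing kernels: the function x to
  \<open>exp (- (\<Sum>l\<in>L. \<delta> x (y l)))\<close> has norm at most 1 in the space of the
  kernel \<open>exp (- (card L * \<delta> x y))\<close>. Indeed it is \<open>exp (- V)\<close> times
  the Gaussian centred at the barycentre, which has norm 1.\<close>

lemma Schoenberg_gaussian_ge:
  fixes \<delta> :: "'a \<Rightarrow> 'a \<Rightarrow> real" and x :: "'i \<Rightarrow> 'a" and y :: "'l \<Rightarrow> 'a" and c :: "'i \<Rightarrow> real"
  assumes \<delta>: "conditionally_negative S \<delta>"
    and sym: "\<And>x y. x \<in> S \<Longrightarrow> y \<in> S \<Longrightarrow> \<delta> x y = \<delta> y x"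
    and nonneg: "\<And>x y. x \<in> S \<Longrightarrow> y \<in> S \<Longrightarrow> 0 \<le> \<delta> x y"
    and I: "finite I" "x ` I \<subseteq> S" and L: "finite L" "L \<noteq> {}" "y ` L \<subseteq> S"
  shows "(\<Sum>i\<in>I. c i * exp (- (\<Sum>l\<in>L. \<delta> (x i) (y l))))\<^sup>2 \<le>
    (\<Sum>i\<in>I. \<Sum>j\<in>I. c i * c j * exp (- (card L * \<delta> (x i) (x j))))"
proof -
  define m where "m = real (card L)"
  have m: "m > 0" using L by (simp add: m_def card_gt_0_iff)
  define W where "W = (\<Sum>l\<in>L. \<Sum>k\<in>L. \<delta> (y l) (y k))"
  have "W \<ge> 0" using nonneg[OF subsetD[OF L(3) imageI] subsetD[OF L(3) imageI]]
    by (simp add: W_def sum_nonneg)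
  \<comment> \<open>Geometrically, the sum of the squared distances of the \<open>y l\<close> from
    their barycentre; by Huygens' identity \<open>q i\<close> below is m times the squared distance
    of \<open>x i\<close> from it.\<close>
  define V where "V = W / (2 * m)"
  have "V \<ge> 0" using \<open>W \<ge> 0\<close> m by (simp add: V_def)
  define q :: "'i \<Rightarrow> real" where "q i = (\<Sum>l\<in>L. \<delta> (x i) (y l)) - V" for i
  \<comment> \<open>\<open>A / (2 m)\<close> is the Gram matrix of the \<open>x i\<close> with the barycentre of the \<open>y l\<close> as the origin.\<close>
  define A where "A i j = q i + q j - m * \<delta> (x i) (x j)" for i j
  have psd: "0 \<le> (\<Sum>i\<in>I. \<Sum>j\<in>I. b i * b j * A i j)" for b
  proof -
    define s where "s = (\<Sum>i\<in>I. b i)"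
    define Q where "Q = (\<Sum>i\<in>I. b i * (\<Sum>l\<in>L. \<delta> (x i) (y l)))"
    define F where "F = (\<Sum>i\<in>I. \<Sum>j\<in>I. b i * b j * \<delta> (x i) (x j))"
    \<comment> \<open>The weights of the vector that sums \<open>b i\<close> times
      (\<open>x i\<close> minus barycentre): each \<open>y l\<close> receives the share
      \<open>- s / m\<close>, which makes the total weight 0.\<close>
    define b' :: "'i + 'l \<Rightarrow> real" where "b' = case_sum b (\<lambda>_. - s / m)"
    define z where "z = case_sum x y"
    have "(\<Sum>i\<in>I <+> L. \<Sum>j\<in>I <+> L. b' i * b' j * \<delta> (z i) (z j)) \<le> 0"
    proof (rule conditionally_negativeD[OF \<delta>])
      show "z ` (I <+> L) \<subseteq> S" using I L by (auto simp: z_def)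
      show "(\<Sum>i\<in>I <+> L. b' i) = 0" using I L m by (simp add: sum.Plus b'_def s_def m_def)
    qed (use I L in auto)
    also have "(\<Sum>i\<in>I <+> L. \<Sum>j\<in>I <+> L. b' i * b' j * \<delta> (z i) (z j)) =
       F + (\<Sum>i\<in>I. \<Sum>l\<in>L. b i * (- s / m) * \<delta> (x i) (y l)) +
       (\<Sum>l\<in>L. \<Sum>i\<in>I. (- s / m) * b i * \<delta> (y l) (x i)) +
       (\<Sum>l\<in>L. \<Sum>k\<in>L. (- s / m) * (- s / m) * \<delta> (y l) (y k))"
      using I L by (simp add: sum.Plus b'_def z_def sum.distrib F_def)
    also have "(\<Sum>i\<in>I. \<Sum>l\<in>L. b i * (- s / m) * \<delta> (x i) (y l)) = - s / m * Q"
      by (simp add: Q_def sum_distrib_left mult_ac)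
    also have "(\<Sum>l\<in>L. \<Sum>i\<in>I. (- s / m) * b i * \<delta> (y l) (x i)) = - s / m * Q"
    proof -
      have "(\<Sum>l\<in>L. \<Sum>i\<in>I. (- s / m) * b i * \<delta> (y l) (x i)) = (\<Sum>i\<in>I. \<Sum>l\<in>L. (- s / m) * b i * \<delta> (x i) (y l))"
        using sym[OF subsetD[OF I(2) imageI] subsetD[OF L(3) imageI]]
        by (subst sum.swap) (intro sum.cong refl, simp)
      then show ?thesis by (simp add: Q_def sum_distrib_left mult_ac)
    qed
    also have "(\<Sum>l\<in>L. \<Sum>k\<in>L. (- s / m) * (- s / m) * \<delta> (y l) (y k)) = (s / m)\<^sup>2 * W"
      by (simp add: W_def sum_distrib_left power2_eq_square)
    \<comment> \<open>The left side is -2 times the squared norm of that vector.\<close>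
    finally have 1: "F - 2 * s / m * Q + (s / m)\<^sup>2 * W \<le> 0" by (simp add: mult_ac)
    have "(\<Sum>i\<in>I. \<Sum>j\<in>I. b i * b j * A i j) =
        (\<Sum>i\<in>I. \<Sum>j\<in>I. (b i * q i) * b j) + (\<Sum>i\<in>I. \<Sum>j\<in>I. b i * (b j * q j)) - m * F"
      by (simp add: A_def F_def algebra_simps sum.distrib sum_subtractf sum_distrib_left)
    also have "\<dots> = 2 * s * (\<Sum>i\<in>I. b i * q i) - m * F"
      by (simp add: sum_product[symmetric] s_def)
    also have "(\<Sum>i\<in>I. b i * q i) = Q - V * s"
      by (simp add: q_def Q_def s_def algebra_simps sum_subtractf sum_distrib_left)
    also have "2 * s * (Q - V * s) - m * F = - m * (F - 2 * s / m * Q + (s / m)\<^sup>2 * W)"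
      using m by (simp add: V_def field_simps power2_eq_square)
    also have "\<dots> \<ge> 0"
      using mult_nonneg_nonpos[OF less_imp_le[OF m] 1] by simp
    finally show ?thesis .
  qed
  have "(\<Sum>i\<in>I. c i * exp (- (\<Sum>l\<in>L. \<delta> (x i) (y l))))\<^sup>2 = exp (- V)^2 * (\<Sum>i\<in>I. c i * exp (- q i))\<^sup>2"
    unfolding power_mult_distrib[symmetric] sum_distrib_left
    by (intro arg_cong[where f="\<lambda>x. x\<^sup>2"] sum.cong) (auto simp: q_def mult_ac simp flip: exp_add)
  also have "\<dots> \<le> 1 * (\<Sum>i\<in>I. c i * exp (- q i))\<^sup>2"
    using \<open>V \<ge> 0\<close> by (intro mult_right_mono) (auto intro!: power_le_one)
  \<comment> \<open>By the definition of \<open>A\<close>, the kernel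
    \<open>exp (- (m * \<delta>))\<close> is \<open>exp A\<close> rescaled by
    \<open>exp (- q i)\<close> and \<open>exp (- q j)\<close>; these factors are absorbed into the
    coefficients.\<close>
  also have "(\<Sum>i\<in>I. c i * exp (- q i))\<^sup>2 \<le>
      (\<Sum>i\<in>I. \<Sum>j\<in>I. (c i * exp (- q i)) * (c j * exp (- q j)) * exp (A i j))"
    using sym I by (intro psd_exp_ge psd) (auto simp: A_def)
  also have "\<dots> = (\<Sum>i\<in>I. \<Sum>j\<in>I. c i * c j * exp (- (card L * \<delta> (x i) (x j))))"
  proof (intro sum.cong refl)
    fix i j
    have "exp (- q i) * exp (- q j) * exp (A i j) = exp (- (card L * \<delta> (x i) (x j)))"
      by (simp add: A_def m_def flip: exp_add)
    then show "(c i * exp (- q i)) * (c j * exp (- q j)) * exp (A i j) = c i * c j * exp (- (card L * \<delta> (x i) (x j)))"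
      by (metis (no_types, lifting) mult.assoc mult.left_commute)
  qed
  finally show ?thesis by simp
qed

subsection \<open>Positive definite kernels and pairs of distributions\<close>

text \<open>Since \<open>h\<close> is merely measurable, \<open>R\<close> cannot be approximated by
  finitely supported measures through continuity; independent sampling replaces this. Unit weights
  suffice, because signs can be built into \<open>h\<close>.\<close>

lemma integral_positive_definite_nonneg:
  fixes h :: "'a \<Rightarrow> 'a \<Rightarrow> real"
  assumes R: "prob_space R"
    and h[measurable]: "case_prod h \<in> borel_measurable (R \<Otimes>\<^sub>M R)"
    and bound: "\<And>x y. x \<in> space R \<Longrightarrow> y \<in> space R \<Longrightarrow> \<bar>h x y\<bar> \<le> C"
    and psd: "\<And>n z. (\<And>i. i < n \<Longrightarrow> z i \<in> space R) \<Longrightarrow> 0 \<le> (\<Sum>i<n::nat. \<Sum>j<n. h (z i) (z j))"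
  shows "0 \<le> (\<integral>xy. case_prod h xy \<partial>(R \<Otimes>\<^sub>M R))"
proof -
  interpret R: prob_space R by fact
  interpret RR: pair_prob_space R R ..
  define I where "I = (\<integral>xy. case_prod h xy \<partial>(R \<Otimes>\<^sub>M R))"
  \<comment> \<open>Integrate the inequality for \<open>Suc k\<close> independent points with law \<open>R\<close>; the diagonal contributes at most \<open>C\<close> per point.\<close>
  have key: "0 \<le> C + real k * I" for k
  proof -
    define n where "n = Suc k"
    define Q where "Q = PiM {..<n} (\<lambda>_. R)"
    interpret P: product_prob_space "\<lambda>_. R" "{..<n}" ..
    interpret Q: prob_space Q unfolding Q_def by (intro prob_space_PiM R)
    have comp: "(\<lambda>\<omega>. \<omega> i) \<in> Q \<rightarrow>\<^sub>M R" if "i < n" for i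
      using that unfolding Q_def by (intro measurable_component_singleton) auto
    have sp: "\<omega> i \<in> space R" if "\<omega> \<in> space Q" "i < n" for \<omega> i
      using measurable_space[OF comp[OF that(2)] that(1)] .
    have hm: "(\<lambda>\<omega>. h (\<omega> i) (\<omega> j)) \<in> borel_measurable Q" if "i < n" "j < n" for i j
      using measurable_compose[OF measurable_Pair[OF comp[OF that(1)] comp[OF that(2)]] h] by simp
    have int: "integrable Q (\<lambda>\<omega>. h (\<omega> i) (\<omega> j))" if "i < n" "j < n" for i j
      using that by (intro Q.integrable_const_bound[where B=C] hm AE_I2) (auto intro!: bound sp)
    have off: "(\<integral>\<omega>. h (\<omega> i) (\<omega> j) \<partial>Q) = I" if "i < n" "j < n" "i \<noteq> j" for i j
    proof -
      have "R \<Otimes>\<^sub>M R = distr Q (R \<Otimes>\<^sub>M R) (\<lambda>\<omega>. (\<omega> i, \<omega> j))"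
      proof (rule pair_measure_eqI)
        fix A B assume AB: "A \<in> sets R" "B \<in> sets R"
        have "(\<lambda>\<omega>. (\<omega> i, \<omega> j)) -` (A \<times> B) \<inter> space Q =
            {\<omega>\<in>space Q. \<forall>l\<in>{i, j}. \<omega> l \<in> (if l = i then A else B)}"
          using \<open>i \<noteq> j\<close> by auto
        also have "emeasure Q \<dots> = (\<Prod>l\<in>{i, j}. emeasure R (if l = i then A else B))"
          using that AB unfolding Q_def by (intro P.emeasure_PiM_Collect) auto
        also have "\<dots> = emeasure R A * emeasure R B"
          using \<open>i \<noteq> j\<close> by simp
        finally show "emeasure R A * emeasure R B = emeasure (distr Q (R \<Otimes>\<^sub>M R) (\<lambda>\<omega>. (\<omega> i, \<omega> j))) (A \<times> B)"
          using AB that comp by (subst emeasure_distr) (auto intro!: measurable_Pair)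
      qed (auto intro: R.sigma_finite_measure_axioms)
      then have "I = (\<integral>xy. case_prod h xy \<partial>distr Q (R \<Otimes>\<^sub>M R) (\<lambda>\<omega>. (\<omega> i, \<omega> j)))"
        by (simp add: I_def)
      also have "\<dots> = (\<integral>\<omega>. h (\<omega> i) (\<omega> j) \<partial>Q)"
        using that comp by (subst integral_distr) (auto intro!: measurable_Pair)
      finally show ?thesis by simp
    qed
    have diag: "(\<integral>\<omega>. h (\<omega> i) (\<omega> i) \<partial>Q) \<le> C" if "i < n" for i
    proof -
      have "(\<integral>\<omega>. h (\<omega> i) (\<omega> i) \<partial>Q) \<le> (\<integral>\<omega>. C \<partial>Q)"
        using that by (intro integral_mono int) (auto intro!: abs_le_D1[OF bound] sp)
      then show ?thesis by (simp add: Q.prob_space)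
    qed
    have "0 \<le> (\<integral>\<omega>. (\<Sum>i<n. \<Sum>j<n. h (\<omega> i) (\<omega> j)) \<partial>Q)"
      by (intro integral_nonneg_AE AE_I2 psd sp)
    also have "\<dots> = (\<Sum>i<n. \<Sum>j<n. (\<integral>\<omega>. h (\<omega> i) (\<omega> j) \<partial>Q))"
      by (subst Bochner_Integration.integral_sum)
        (auto intro!: sum.cong Bochner_Integration.integrable_sum int Bochner_Integration.integral_sum)
    also have "\<dots> \<le> (\<Sum>i<n. \<Sum>j<n. if j = i then C else I)"
      using off diag by (intro sum_mono) auto
    also have "\<dots> = (\<Sum>i<n. C + real k * I)"
    proof (intro sum.cong refl)
      fix i assume "i \<in> {..<n}"
      then have "{..<n} \<inter> {j. j = i} = {i}" "card ({..<n} \<inter> - {j. j = i}) = k"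
        by (auto simp: n_def Int_absorb1 Diff_eq[symmetric] card_Diff_subset)
      then show "(\<Sum>j<n. if j = i then C else I) = C + real k * I"
        by (subst sum.If_cases) auto
    qed
    finally show ?thesis by (simp add: n_def zero_le_mult_iff)
  qed
  have "I \<ge> 0"
  proof (rule ccontr)
    assume "\<not> I \<ge> 0"
    then obtain k :: nat where "C < real k * (- I)"
      using reals_Archimedean3[of "- I"] by fastforce
    with key[of k] show False by simp
  qed
  then show ?thesis by (simp add: I_def)
qed

text \<open>The signed measure P - Q is sampled through a probability measure: a point of
  \<open>P \<Otimes>\<^sub>M Q\<close> contributes its first component with weight 1 and its second
  with weight -1. A sample of n such pairs is a family indexed by a disjoint sum, hence the index
  type \<open>nat + nat\<close>.\<close>

lemma integral_kernel_diff_ge: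
  fixes k :: "'a \<Rightarrow> 'a \<Rightarrow> real" and f :: "'a \<Rightarrow> real"
  assumes P: "prob_space P" "sets P = sets N" and Q: "prob_space Q" "sets Q = sets N"
    and k: "case_prod k \<in> borel_measurable (N \<Otimes>\<^sub>M N)" "\<And>x y. x \<in> space N \<Longrightarrow> y \<in> space N \<Longrightarrow> \<bar>k x y\<bar> \<le> 1"
    and sym: "\<And>x y. x \<in> space N \<Longrightarrow> y \<in> space N \<Longrightarrow> k x y = k y x"
    and f: "f \<in> borel_measurable N" "\<And>x. x \<in> space N \<Longrightarrow> \<bar>f x\<bar> \<le> 1"
    and psd: "\<And>(I :: (nat + nat) set) x c. finite I \<Longrightarrow> (\<And>i. i \<in> I \<Longrightarrow> x i \<in> space N) \<Longrightarrow>
       (\<Sum>i\<in>I. c i * f (x i))\<^sup>2 \<le> (\<Sum>i\<in>I. \<Sum>j\<in>I. c i * c j * k (x i) (x j))"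
  shows "((\<integral>x. f x \<partial>P) - (\<integral>x. f x \<partial>Q))\<^sup>2 \<le>
    (\<integral>z. case_prod k z \<partial>(P \<Otimes>\<^sub>M P)) + (\<integral>z. case_prod k z \<partial>(Q \<Otimes>\<^sub>M Q)) - 2 * (\<integral>z. case_prod k z \<partial>(P \<Otimes>\<^sub>M Q))"
proof -
  interpret P: prob_space P by fact
  interpret Q: prob_space Q by fact
  interpret PQ: pair_prob_space P Q ..
  have sp: "space P = space N" "space Q = space N"
    using P(2) Q(2) by (auto dest: sets_eq_imp_space_eq)
  note [measurable_cong] = P(2) Q(2)
  note [measurable] = k(1) f(1)
  define R where "R = P \<Otimes>\<^sub>M Q"
  interpret R: prob_space R unfolding R_def by (rule PQ.prob_space_axioms)
  have [measurable_cong]: "sets R = sets (N \<Otimes>\<^sub>M N)"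
    unfolding R_def by (intro sets_pair_measure_cong P Q)
  have spR: "space R = space N \<times> space N" by (simp add: R_def space_pair_measure sp)
  interpret RR: pair_prob_space R R ..
  have dfst: "distr R N fst = P"
  proof (rule measure_eqI)
    fix A assume "A \<in> sets (distr R N fst)"
    then have A: "A \<in> sets N" by simp
    then have "fst -` A \<inter> space R = A \<times> space Q"
      using sets.sets_into_space[OF A] by (auto simp: spR sp)
    then show "emeasure (distr R N fst) A = emeasure P A"
      using A by (simp add: emeasure_distr R_def Q.emeasure_pair_measure_Times Q.emeasure_space_1 P(2))
  qed (simp add: P(2))
  have dsnd: "distr R N snd = Q"
  proof (rule measure_eqI)
    fix A assume "A \<in> sets (distr R N snd)"
    then have A: "A \<in> sets N" by simp
    then have "snd -` A \<inter> space R = space P \<times> A"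
      using sets.sets_into_space[OF A] by (auto simp: spR sp)
    then show "emeasure (distr R N snd) A = emeasure Q A"
      using A by (simp add: emeasure_distr R_def Q.emeasure_pair_measure_Times P.emeasure_space_1 Q(2))
  qed (simp add: Q(2))
  \<comment> \<open>The assumption \<open>psd\<close> says exactly that this difference is a
    positive semidefinite kernel. Its energy is that of \<open>k\<close> minus the square to be
    bounded.\<close>
  define g where "g x y = k x y - f x * f y" for x y
  have g[measurable]: "case_prod g \<in> borel_measurable (N \<Otimes>\<^sub>M N)"
    unfolding g_def by measurable
  have gb: "\<bar>g x y\<bar> \<le> 2" if "x \<in> space N" "y \<in> space N" for x y
  proof -
    have "\<bar>f x * f y\<bar> \<le> 1" using mult_mono[OF f(2) f(2), of x y] that by (simp add: abs_mult)
    then show ?thesis using k(2)[OF that] unfolding g_def by linarith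
  qed
  have proj: "(\<integral>z. g (u (fst z)) (v (snd z)) \<partial>(R \<Otimes>\<^sub>M R)) =
      (\<integral>z. case_prod k z \<partial>(A \<Otimes>\<^sub>M B)) - (\<integral>x. f x \<partial>A) * (\<integral>x. f x \<partial>B)"
    if "u \<in> R \<rightarrow>\<^sub>M N" "v \<in> R \<rightarrow>\<^sub>M N" and A: "distr R N u = A" "prob_space A"
      and B: "distr R N v = B" "prob_space B" for u v A B
  proof -
    note [measurable] = that(1,2)
    interpret A: prob_space A by fact
    interpret B: prob_space B by fact
    interpret AB: pair_prob_space A B ..
    have [measurable_cong]: "sets A = sets N" "sets B = sets N"
      using A(1) B(1) by auto
    then have spAB: "space A = space N" "space B = space N"
      by (auto dest: sets_eq_imp_space_eq)
    have "A \<Otimes>\<^sub>M B = distr (R \<Otimes>\<^sub>M R) (N \<Otimes>\<^sub>M N) (\<lambda>(x, y). (u x, v y))"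
      using pair_measure_distr[of u R N v R N] B.sigma_finite_measure_axioms A B by simp
    then have "(\<integral>z. case_prod g z \<partial>(A \<Otimes>\<^sub>M B)) = (\<integral>z. g (u (fst z)) (v (snd z)) \<partial>(R \<Otimes>\<^sub>M R))"
      by (simp add: integral_distr split_beta)
    moreover have ik: "integrable (A \<Otimes>\<^sub>M B) (case_prod k)"
      using k(2) by (intro AB.integrable_const_bound[where B=1] AE_I2)
        (auto simp: space_pair_measure spAB)
    moreover have iff: "integrable (A \<Otimes>\<^sub>M B) (\<lambda>z. f (fst z) * f (snd z))"
      using mult_mono[OF f(2) f(2)] by (intro AB.integrable_const_bound[where B=1] AE_I2)
        (auto simp: space_pair_measure spAB abs_mult)
    moreover have "(\<integral>z. f (fst z) * f (snd z) \<partial>(A \<Otimes>\<^sub>M B)) = (\<integral>x. f x \<partial>A) * (\<integral>x. f x \<partial>B)"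
      using AB.integral_fst'[OF iff] by simp
    moreover have "case_prod g = (\<lambda>z. case_prod k z - f (fst z) * f (snd z))"
      by (auto simp: g_def)
    ultimately show ?thesis by simp
  qed
  \<comment> \<open>The product of the signed measures (point mass at \<open>fst z\<close> minus
    point mass at \<open>snd z\<close>, and likewise for \<open>z'\<close>), integrated against
    \<open>g\<close>.\<close>
  define h where "h z z' = g (fst z) (fst z') + g (snd z) (snd z') - g (fst z) (snd z') - g (snd z) (fst z')"
    for z z'
  have int: "integrable (R \<Otimes>\<^sub>M R) (\<lambda>z. g (u (fst z)) (v (snd z)))"
    if [measurable]: "u \<in> R \<rightarrow>\<^sub>M N" "v \<in> R \<rightarrow>\<^sub>M N" for u v
    using measurable_space[OF that(1)] measurable_space[OF that(2)]
    by (intro RR.integrable_const_bound[where B=2] AE_I2) (auto simp: space_pair_measure intro!: gb)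
  have "0 \<le> (\<integral>z. case_prod h z \<partial>(R \<Otimes>\<^sub>M R))"
  proof (rule integral_positive_definite_nonneg[where C=8])
    show "prob_space R" by (rule R.prob_space_axioms)
    show "case_prod h \<in> borel_measurable (R \<Otimes>\<^sub>M R)"
      unfolding h_def by measurable
    show "\<bar>h x y\<bar> \<le> 8" if "x \<in> space R" "y \<in> space R" for x y
    proof -
      have m: "fst x \<in> space N" "snd x \<in> space N" "fst y \<in> space N" "snd y \<in> space N"
        using that by (auto simp: spR)
      show ?thesis
        using gb[OF m(1,3)] gb[OF m(2,4)] gb[OF m(1,4)] gb[OF m(2,3)] unfolding h_def by linarith
    qed
    fix n and z :: "nat \<Rightarrow> 'a \<times> 'a" assume z: "\<And>i. i < n \<Longrightarrow> z i \<in> space R"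
    define x where "x = case_sum (\<lambda>i. fst (z i)) (\<lambda>i. snd (z i))"
    define c :: "nat + nat \<Rightarrow> real" where "c = case_sum (\<lambda>i. 1) (\<lambda>i. -1)"
    let ?I = "{..<n} <+> {..<n}"
    have "(\<Sum>i\<in>?I. c i * f (x i)) * (\<Sum>i\<in>?I. c i * f (x i)) \<le> (\<Sum>i\<in>?I. \<Sum>j\<in>?I. c i * c j * k (x i) (x j))"
      unfolding power2_eq_square[symmetric] using z by (intro psd) (auto simp: x_def spR mem_Times_iff)
    then have "0 \<le> (\<Sum>i\<in>?I. \<Sum>j\<in>?I. c i * c j * g (x i) (x j))"
      by (simp add: g_def right_diff_distrib sum_subtractf sum_product mult_ac)
    also have "\<dots> = (\<Sum>i<n. \<Sum>j<n. h (z i) (z j))"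
      by (simp add: sum.Plus c_def x_def h_def sum.distrib sum_subtractf sum_negf)
    finally show "0 \<le> (\<Sum>i<n. \<Sum>j<n. h (z i) (z j))" .
  qed
  also have "(\<integral>z. case_prod h z \<partial>(R \<Otimes>\<^sub>M R)) =
     (\<integral>z. g (fst (fst z)) (fst (snd z)) \<partial>(R \<Otimes>\<^sub>M R)) + (\<integral>z. g (snd (fst z)) (snd (snd z)) \<partial>(R \<Otimes>\<^sub>M R)) -
     (\<integral>z. g (fst (fst z)) (snd (snd z)) \<partial>(R \<Otimes>\<^sub>M R)) - (\<integral>z. g (snd (fst z)) (fst (snd z)) \<partial>(R \<Otimes>\<^sub>M R))"
    by (simp add: h_def split_beta int)
  also have "(\<integral>z. g (snd (fst z)) (fst (snd z)) \<partial>(R \<Otimes>\<^sub>M R)) =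
      (\<integral>z. g (fst (fst z)) (snd (snd z)) \<partial>(R \<Otimes>\<^sub>M R))"
  proof -
    have "(\<integral>z. g (snd (fst z)) (fst (snd z)) \<partial>(R \<Otimes>\<^sub>M R)) = (\<integral>(z, z'). g (snd z') (fst z) \<partial>(R \<Otimes>\<^sub>M R))"
      by (subst RR.integral_product_swap[symmetric]) (auto simp: split_beta)
    also have "\<dots> = (\<integral>z. g (fst (fst z)) (snd (snd z)) \<partial>(R \<Otimes>\<^sub>M R))"
      by (intro Bochner_Integration.integral_cong) (auto simp: space_pair_measure spR g_def sym)
    finally show ?thesis .
  qed
  finally show ?thesis
    using proj[OF _ _ dfst P(1) dfst P(1)] proj[OF _ _ dsnd Q(1) dsnd Q(1)] proj[OF _ _ dfst P(1) dsnd Q(1)]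
    by (simp add: power2_eq_square algebra_simps)
qed

subsection \<open>Square roots as mixtures of Gaussians\<close>

text \<open>The value is twice the square root of pi. It is a common factor of all three
  expectations, which are only compared with 0, so it stays unevaluated. At s = 0 the integrand is 0
  by the division convention.\<close>

definition sqrt_const :: real where
  "sqrt_const = (\<integral>s. (1 - exp (- s\<^sup>2)) / s\<^sup>2 \<partial>lborel)"

lemma integrable_gaussian_quotient: "integrable lborel (\<lambda>s::real. (1 - exp (- s\<^sup>2)) / s\<^sup>2)"
proof (rule Bochner_Integration.integrable_bound)
  show "integrable lborel (\<lambda>s::real. 2 * inverse (1 + s\<^sup>2))"
    using integrable_inverse_1_plus_square by (simp add: set_integrable_def einterval_def)
  \<comment> \<open>The numerator is at most u, which is good near 0, and at most 1, which is good
    in the tail; adding the two bounds gives the factor 2.\<close>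
  have "(1 - exp (- u)) / u \<le> 2 * inverse (1 + u)" if "u \<ge> 0" for u :: real
  proof (cases "u = 0")
    case False
    have "1 - exp (- u) \<le> u" using exp_ge_add_one_self[of "- u"] by simp
    moreover have "(1 - exp (- u)) * u \<le> 1 * u" using that by (intro mult_right_mono) auto
    ultimately have "(1 - exp (- u)) * (1 + u) \<le> 2 * u" by (simp add: algebra_simps)
    then show ?thesis using that False by (simp add: field_simps)
  qed simp
  then show "AE s::real in lborel. norm ((1 - exp (- s\<^sup>2)) / s\<^sup>2) \<le> norm (2 * inverse (1 + s\<^sup>2))"
    by (intro AE_I2) simp
qed simp

text \<open>Substituting \<open>sqrt D * s\<close> for s turns the factor \<open>D\<close> into
  \<open>D / sqrt D\<close>. The case \<open>D = 0\<close> is separate because the scaling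
  degenerates.\<close>

lemma sqrt_gaussian_integral:
  fixes D :: real assumes "D \<ge> 0"
  shows "integrable lborel (\<lambda>s. (1 - exp (- (s\<^sup>2 * D))) / s\<^sup>2)"
    and "(\<integral>s. (1 - exp (- (s\<^sup>2 * D))) / s\<^sup>2 \<partial>lborel) = sqrt_const * sqrt D"
proof -
  define f where "f s = (1 - exp (- s\<^sup>2)) / s\<^sup>2" for s :: real
  have eq: "(1 - exp (- (s\<^sup>2 * D))) / s\<^sup>2 = D * f (0 + sqrt D * s)" for s
    using assms by (cases "s = 0") (auto simp: f_def power_mult_distrib mult.commute)
  have "integrable lborel (\<lambda>s. (1 - exp (- (s\<^sup>2 * D))) / s\<^sup>2) \<and>
     (\<integral>s. (1 - exp (- (s\<^sup>2 * D))) / s\<^sup>2 \<partial>lborel) = sqrt_const * sqrt D"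
  proof (cases "D = 0")
    case False
    then have D: "D > 0" using assms by simp
    have "integrable lborel f" unfolding f_def by (rule integrable_gaussian_quotient)
    from lborel_integrable_real_affine[OF this, of "sqrt D" 0] D
    have "integrable lborel (\<lambda>s. f (0 + sqrt D * s))" by simp
    moreover have "sqrt_const = sqrt D * (\<integral>s. f (0 + sqrt D * s) \<partial>lborel)"
      using lborel_integral_real_affine[of "sqrt D" f 0] D by (simp add: sqrt_const_def f_def)
    moreover have "D = sqrt D * sqrt D" using D by simp
    ultimately show ?thesis
      unfolding eq by (metis integrable_mult_right integral_mult_right_zero mult.assoc mult.commute)
  qed simp
  then show "integrable lborel (\<lambda>s. (1 - exp (- (s\<^sup>2 * D))) / s\<^sup>2)"
    and "(\<integral>s. (1 - exp (- (s\<^sup>2 * D))) / s\<^sup>2 \<partial>lborel) = sqrt_const * sqrt D" by auto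
qed

text \<open>Fubini: the integrand is nonnegative, so joint integrability reduces to that of its
  integral over s, a multiple of \<open>sqrt (W z)\<close>.\<close>

lemma expectation_sqrt_gaussian:
  assumes L: "prob_space L" and W[measurable]: "W \<in> borel_measurable L"
    and nonneg: "\<And>z. z \<in> space L \<Longrightarrow> 0 \<le> W z" and int: "integrable L (\<lambda>z. sqrt (W z))"
  shows "integrable lborel (\<lambda>s. (1 - (\<integral>z. exp (- (s\<^sup>2 * W z)) \<partial>L)) / s\<^sup>2)"
    and "(\<integral>s. (1 - (\<integral>z. exp (- (s\<^sup>2 * W z)) \<partial>L)) / s\<^sup>2 \<partial>lborel) = sqrt_const * (\<integral>z. sqrt (W z) \<partial>L)"
proof -
  interpret L: prob_space L by fact
  interpret pair_sigma_finite L lborel ..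
  define F where "F z s = (1 - exp (- (s\<^sup>2 * W z))) / s\<^sup>2" for z and s :: real
  have F[measurable]: "case_prod F \<in> borel_measurable (L \<Otimes>\<^sub>M lborel)"
    unfolding F_def by measurable
  have Fz: "integrable lborel (F z)" "(\<integral>s. F z s \<partial>lborel) = sqrt_const * sqrt (W z)"
    if "z \<in> space L" for z
    unfolding F_def using sqrt_gaussian_integral[OF nonneg[OF that]] by auto
  have abs: "\<bar>F z s\<bar> = F z s" if "z \<in> space L" for z s
    using nonneg[OF that] by (simp add: F_def)
  have intF: "integrable (L \<Otimes>\<^sub>M lborel) (case_prod F)"
  proof (rule Fubini_integrable)
    have "integrable L (\<lambda>z. sqrt_const * sqrt (W z))" using int by simp
    then show "integrable L (\<lambda>z. \<integral>s. norm (case_prod F (z, s)) \<partial>lborel)"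
      by (rule Bochner_Integration.integrable_cong[THEN iffD1, rotated 2])
        (auto simp: abs Fz)
  qed (auto intro!: AE_I2 Fz)
  have "(\<integral>z. F z s \<partial>L) = (1 - (\<integral>z. exp (- (s\<^sup>2 * W z)) \<partial>L)) / s\<^sup>2" for s
  proof -
    have "integrable L (\<lambda>z. exp (- (s\<^sup>2 * W z)))"
      using nonneg by (intro L.integrable_const_bound[where B=1]) auto
    then show ?thesis by (simp add: F_def L.prob_space)
  qed
  note eq = this
  show "integrable lborel (\<lambda>s. (1 - (\<integral>z. exp (- (s\<^sup>2 * W z)) \<partial>L)) / s\<^sup>2)"
    using integrable_snd[OF intF] unfolding eq .
  have "(\<integral>s. (1 - (\<integral>z. exp (- (s\<^sup>2 * W z)) \<partial>L)) / s\<^sup>2 \<partial>lborel) = (\<integral>z. \<integral>s. F z s \<partial>lborel \<partial>L)"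
    using Fubini_integral[OF intF] unfolding eq by simp
  also have "\<dots> = (\<integral>z. sqrt_const * sqrt (W z) \<partial>L)"
    by (intro Bochner_Integration.integral_cong refl Fz)
  finally show "(\<integral>s. (1 - (\<integral>z. exp (- (s\<^sup>2 * W z)) \<partial>L)) / s\<^sup>2 \<partial>lborel) = sqrt_const * (\<integral>z. sqrt (W z) \<partial>L)"
    by simp
qed

text \<open>Dominated convergence with the constant bound 1; no moment of \<open>W\<close> enters.
  This turns statements about almost every s into statements about every s.\<close>

lemma continuous_expectation_gaussian:
  assumes L: "prob_space L" and W[measurable]: "W \<in> borel_measurable L"
    and nonneg: "\<And>z. z \<in> space L \<Longrightarrow> 0 \<le> W z"
  shows "continuous_on UNIV (\<lambda>s::real. \<integral>z. exp (- (s\<^sup>2 * W z)) \<partial>L)"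
proof -
  interpret L: prob_space L by fact
  show ?thesis
    unfolding continuous_on_sequentially o_def
    by (intro ballI allI impI integral_dominated_convergence[where w="\<lambda>_. 1"] AE_I2)
      (auto intro!: tendsto_intros simp: nonneg)
qed

lemma continuous_AE_zero_imp_zero:
  fixes f :: "real \<Rightarrow> real"
  assumes f: "continuous_on UNIV f" and AE: "AE x in lborel. f x = 0"
  shows "f x = 0"
proof (rule ccontr)
  assume "f x \<noteq> 0"
  have "open {x. f x \<noteq> 0}"
    using f by (intro open_Collect_neq continuous_on_const)
  moreover have "{x. f x \<noteq> 0} \<in> null_sets lborel"
    using AE borel_measurable_continuous_onI[OF f] by (subst (asm) AE_iff_null) auto
  then have "negligible {x. f x \<noteq> 0}"
    by (simp add: negligible_iff_null_sets null_sets_completionI)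
  ultimately show False
    using open_not_negligible[of "{x. f x \<noteq> 0}"] \<open>f x \<noteq> 0\<close> by auto
qed

subsection \<open>Products of functions determining a distribution\<close>

text \<open>Weierstrass approximation passes from powers of \<open>g\<close> to continuous functions
  of \<open>g\<close>, and ramps pass from these to an indicator. The weight \<open>u\<close> keeps
  all other factors fixed, so that several functions can be treated one at a time with polynomials
  in one variable.\<close>

lemma moments_determine_superlevel_integral:
  fixes u g :: "'a \<Rightarrow> real"
  assumes P: "prob_space P" "sets P = sets N" and Q: "prob_space Q" "sets Q = sets N"
    and u[measurable]: "u \<in> borel_measurable N" "\<And>x. x \<in> space N \<Longrightarrow> \<bar>u x\<bar> \<le> 1"
    and g[measurable]: "g \<in> borel_measurable N" "\<And>x. x \<in> space N \<Longrightarrow> g x \<in> {0..1}"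
    and moments: "\<And>k. (\<integral>x. u x * g x ^ k \<partial>P) = (\<integral>x. u x * g x ^ k \<partial>Q)"
  shows "(\<integral>x. u x * (if r < g x then 1 else 0) \<partial>P) = (\<integral>x. u x * (if r < g x then 1 else 0) \<partial>Q)"
proof -
  interpret P: prob_space P by fact
  interpret Q: prob_space Q by fact
  have sp: "space P = space N" "space Q = space N"
    using P(2) Q(2) by (auto dest: sets_eq_imp_space_eq)
  note [measurable_cong] = P(2) Q(2)
  have int: "integrable P (\<lambda>x. u x * v x)" "integrable Q (\<lambda>x. u x * v x)"
    if v: "v \<in> borel_measurable N" and vb: "\<And>x. x \<in> space N \<Longrightarrow> \<bar>v x\<bar> \<le> b" for v b
  proof -
    note [measurable] = v
    have "\<bar>u x * v x\<bar> \<le> b" if "x \<in> space N" for x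
      using mult_mono[OF u(2)[OF that] vb[OF that]] by (simp add: abs_mult)
    then show "integrable P (\<lambda>x. u x * v x)" "integrable Q (\<lambda>x. u x * v x)"
      by (auto intro!: P.integrable_const_bound[where B=b] Q.integrable_const_bound[where B=b] AE_I2 simp: sp)
  qed
  have cont: "(\<integral>x. u x * \<phi> (g x) \<partial>P) = (\<integral>x. u x * \<phi> (g x) \<partial>Q)"
    if \<phi>: "continuous_on UNIV \<phi>" "\<And>t. \<bar>\<phi> t\<bar> \<le> 1" for \<phi> :: "real \<Rightarrow> real"
  proof -
    have [measurable]: "\<phi> \<in> borel_measurable borel" using \<phi>(1) by (rule borel_measurable_continuous_onI)
    have "\<bar>(\<integral>x. u x * \<phi> (g x) \<partial>P) - (\<integral>x. u x * \<phi> (g x) \<partial>Q)\<bar> \<le> 2 * e" if "e > 0" for e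
    proof -
      obtain q where q: "real_polynomial_function q" "\<And>t. t \<in> {0..1} \<Longrightarrow> \<bar>\<phi> t - q t\<bar> < e"
        using Stone_Weierstrass_real_polynomial_function[of "{0..1}" \<phi> e] \<phi>(1) \<open>e > 0\<close>
        by (auto intro: continuous_on_subset)
      then obtain a n where qa: "q = (\<lambda>t. \<Sum>i\<le>n. a i * t ^ i)"
        by (auto simp: real_polynomial_function_iff_sum)
      have pow: "integrable P (\<lambda>x. u x * g x ^ i)" "integrable Q (\<lambda>x. u x * g x ^ i)" for i
        using g(2) by (auto intro!: int[of _ 1] simp: power_le_one)
      have "(\<integral>x. u x * q (g x) \<partial>P) = (\<Sum>i\<le>n. a i * (\<integral>x. u x * g x ^ i \<partial>P))"
        "(\<integral>x. u x * q (g x) \<partial>Q) = (\<Sum>i\<le>n. a i * (\<integral>x. u x * g x ^ i \<partial>Q))"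
        using pow by (simp_all add: qa sum_distrib_left mult.left_commute[of _ "a _"])
      then have qq: "(\<integral>x. u x * q (g x) \<partial>P) = (\<integral>x. u x * q (g x) \<partial>Q)"
        by (simp add: moments)
      have mq[measurable]: "q \<in> borel_measurable borel" unfolding qa by measurable
      have approx: "\<bar>(\<integral>x. u x * \<phi> (g x) \<partial>L) - (\<integral>x. u x * q (g x) \<partial>L)\<bar> \<le> e"
        if L: "prob_space L" "sets L = sets N"
          "\<And>v b. v \<in> borel_measurable N \<Longrightarrow> (\<And>x. x \<in> space N \<Longrightarrow> \<bar>v x\<bar> \<le> b) \<Longrightarrow> integrable L (\<lambda>x. u x * v x)" for L
      proof -
        interpret L: prob_space L by fact
        have spL: "space L = space N" using L(2) by (rule sets_eq_imp_space_eq)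
        have qb: "\<bar>q (g x)\<bar> \<le> 1 + e" if "x \<in> space N" for x
          using q(2)[OF g(2)[OF that]] \<phi>(2)[of "g x"] by linarith
        have i1: "integrable L (\<lambda>x. u x * \<phi> (g x))" using \<phi>(2) by (intro L(3)[of _ 1]) auto
        have i2: "integrable L (\<lambda>x. u x * q (g x))" using qb by (intro L(3)[of _ "1 + e"]) auto
        have "\<bar>(\<integral>x. u x * \<phi> (g x) \<partial>L) - (\<integral>x. u x * q (g x) \<partial>L)\<bar> = \<bar>\<integral>x. u x * \<phi> (g x) - u x * q (g x) \<partial>L\<bar>"
          using i1 i2 by simp
        also have "\<dots> \<le> (\<integral>x. \<bar>u x * \<phi> (g x) - u x * q (g x)\<bar> \<partial>L)"
          by (rule integral_abs_bound)
        also have "\<dots> \<le> (\<integral>x. e \<partial>L)"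
        proof (rule integral_mono)
          fix x assume "x \<in> space L"
          then have x: "x \<in> space N" by (simp add: spL)
          have "\<bar>u x * \<phi> (g x) - u x * q (g x)\<bar> = \<bar>u x\<bar> * \<bar>\<phi> (g x) - q (g x)\<bar>"
            by (simp flip: right_diff_distrib add: abs_mult)
          also have "\<dots> \<le> 1 * e"
            using u(2)[OF x] q(2)[OF g(2)[OF x]] by (intro mult_mono) auto
          finally show "\<bar>u x * \<phi> (g x) - u x * q (g x)\<bar> \<le> e" by simp
        qed (use i1 i2 in auto)
        finally show ?thesis by (simp add: L.prob_space)
      qed
      show ?thesis
      proof -
        have "\<bar>(\<integral>x. u x * \<phi> (g x) \<partial>P) - (\<integral>x. u x * q (g x) \<partial>P)\<bar> \<le> e"
          by (rule approx[OF P]) (rule int)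
        moreover have "\<bar>(\<integral>x. u x * \<phi> (g x) \<partial>Q) - (\<integral>x. u x * q (g x) \<partial>Q)\<bar> \<le> e"
          by (rule approx[OF Q]) (rule int)
        ultimately show ?thesis using qq by linarith
      qed
    qed
    \<comment> \<open>A quarter of the distance as e would bound the distance by its own
      half.\<close>
    from this[of "\<bar>(\<integral>x. u x * \<phi> (g x) \<partial>P) - (\<integral>x. u x * \<phi> (g x) \<partial>Q)\<bar> / 4"] show ?thesis
      by (cases "(\<integral>x. u x * \<phi> (g x) \<partial>P) = (\<integral>x. u x * \<phi> (g x) \<partial>Q)") auto
  qed
  \<comment> \<open>Ramps that vanish up to r and, for positive n, equal 1 from r + 1/n on. The
    value 0 at r itself makes the limit the indicator of the strict inequality.\<close>
  define \<phi> :: "nat \<Rightarrow> real \<Rightarrow> real" where "\<phi> n t = min 1 (max 0 (real n * (t - r)))" for n t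
  have c\<phi>: "continuous_on UNIV (\<phi> n)" for n
    unfolding \<phi>_def by (intro continuous_intros)
  have b\<phi>: "\<bar>\<phi> n t\<bar> \<le> 1" for n t by (auto simp: \<phi>_def)
  have [measurable]: "\<phi> n \<in> borel_measurable borel" for n
    using c\<phi> by (rule borel_measurable_continuous_onI)
  have lim: "(\<lambda>n. \<phi> n t) \<longlonglongrightarrow> (if r < t then 1 else 0)" for t
  proof (cases "r < t")
    case True
    obtain m where m: "1 < real m * (t - r)"
      using reals_Archimedean3[of "t - r"] True by auto
    have "eventually (\<lambda>n. \<phi> n t = 1) sequentially"
      using eventually_ge_at_top[of m]
    proof eventually_elim
      case (elim n)
      then have "real m * (t - r) \<le> real n * (t - r)" using True by (intro mult_right_mono) auto
      then show ?case using m by (simp add: \<phi>_def)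
    qed
    then show ?thesis using True by (simp add: tendsto_eventually)
  next
    case False
    then have "\<phi> n t = 0" for n by (simp add: \<phi>_def mult_nonneg_nonpos)
    then show ?thesis using False by simp
  qed
  have conv: "(\<lambda>n. \<integral>x. u x * \<phi> n (g x) \<partial>L) \<longlonglongrightarrow> (\<integral>x. u x * (if r < g x then 1 else 0) \<partial>L)"
    if L: "prob_space L" "sets L = sets N" for L
  proof -
    interpret L: prob_space L by fact
    note [measurable_cong] = L(2)
    have spL: "space L = space N" using L(2) by (rule sets_eq_imp_space_eq)
    have "\<bar>u x\<bar> * \<bar>\<phi> n (g x)\<bar> \<le> 1 * 1" if "x \<in> space N" for n x
      using u(2)[OF that] b\<phi> by (intro mult_mono) auto
    then show ?thesis
      by (intro integral_dominated_convergence[where w="\<lambda>_. 1"] AE_I2 tendsto_mult tendsto_const lim)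
        (auto simp: spL abs_mult)
  qed
  show ?thesis
    using LIMSEQ_unique[OF conv[OF P]] conv[OF Q] cont[OF c\<phi> b\<phi>] by simp
qed

text \<open>The induction converts one function after another into an indicator while an arbitrary
  product of the functions remains as a factor. That product supplies the moments for the next
  conversion, so the hypothesis is generalized over \<open>is\<close>.\<close>

lemma product_moments_determine_superlevel_sets:
  fixes g :: "'i \<Rightarrow> 'a \<Rightarrow> real"
  assumes P: "prob_space P" "sets P = sets N" and Q: "prob_space Q" "sets Q = sets N"
    and g[measurable]: "\<And>i. i \<in> J \<Longrightarrow> g i \<in> borel_measurable N"
      "\<And>i x. i \<in> J \<Longrightarrow> x \<in> space N \<Longrightarrow> g i x \<in> {0..1}"
    and moments: "\<And>is. set is \<subseteq> J \<Longrightarrow>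
      (\<integral>x. (\<Prod>i\<leftarrow>is. g i x) \<partial>P) = (\<integral>x. (\<Prod>i\<leftarrow>is. g i x) \<partial>Q)"
    and zs: "fst ` set zs \<subseteq> J"
  shows "emeasure P {x \<in> space N. \<forall>(i, r) \<in> set zs. r < g i x} =
    emeasure Q {x \<in> space N. \<forall>(i, r) \<in> set zs. r < g i x}"
proof -
  interpret P: prob_space P by fact
  interpret Q: prob_space Q by fact
  have sp: "space P = space N" "space Q = space N"
    using P(2) Q(2) by (auto dest: sets_eq_imp_space_eq)
  note [measurable_cong] = P(2) Q(2)
  define h where "h zs x = (\<Prod>(i, r)\<leftarrow>zs. if r < g i x then 1 else 0 :: real)" for zs x
  have mprod: "(\<lambda>x. \<Prod>i\<leftarrow>is. g i x) \<in> borel_measurable N" if "set is \<subseteq> J" for "is"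
    using that by (induction "is") auto
  have bprod: "(\<Prod>i\<leftarrow>is. g i x) \<in> {0..1}" if "set is \<subseteq> J" "x \<in> space N" for "is" x
    using that g(2) by (induction "is") (auto intro!: mult_nonneg_nonneg mult_le_one)
  have h01: "h zs x \<in> {0..1}" for zs x
    unfolding h_def by (induction zs) auto
  have mh: "h zs \<in> borel_measurable N" if "fst ` set zs \<subseteq> J" for zs
    using that by (induction zs) (auto simp: h_def[abs_def])
  have "(\<integral>x. h zs x * (\<Prod>i\<leftarrow>is. g i x) \<partial>P) = (\<integral>x. h zs x * (\<Prod>i\<leftarrow>is. g i x) \<partial>Q)"
    if "fst ` set zs \<subseteq> J" "set is \<subseteq> J" for zs "is"
    using that
  proof (induction zs arbitrary: "is")
    case Nil
    then show ?case using moments by (simp add: h_def)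
  next
    case (Cons z zs)
    obtain j r where z: "z = (j, r)" by force
    have j: "j \<in> J" and zs: "fst ` set zs \<subseteq> J" using Cons.prems z by auto
    define u where "u x = h zs x * (\<Prod>i\<leftarrow>is. g i x)" for x
    have "(\<integral>x. u x * (if r < g j x then 1 else 0) \<partial>P) = (\<integral>x. u x * (if r < g j x then 1 else 0) \<partial>Q)"
    proof (rule moments_determine_superlevel_integral[OF P Q])
      show "u \<in> borel_measurable N"
        using mh[OF zs] mprod[OF Cons.prems(2)] unfolding u_def by (intro borel_measurable_times) auto
      show "\<bar>u x\<bar> \<le> 1" if "x \<in> space N" for x
        using h01[of zs x] bprod[OF Cons.prems(2) that] by (auto simp: u_def abs_mult intro!: mult_le_one)
      show "g j \<in> borel_measurable N" "\<And>x. x \<in> space N \<Longrightarrow> g j x \<in> {0..1}"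
        using g j by auto
      show "(\<integral>x. u x * g j x ^ k \<partial>P) = (\<integral>x. u x * g j x ^ k \<partial>Q)" for k
      proof -
        \<comment> \<open>Appending k copies of \<open>j\<close> produces the k-th power; this is
          why moments are indexed by lists with repetition.\<close>
        have "set (is @ replicate k j) \<subseteq> J" using Cons.prems j by auto
        from Cons.IH[OF zs this] show ?thesis
          by (simp add: u_def prod_list_replicate mult.assoc)
      qed
    qed
    then show ?case by (simp add: u_def z h_def mult_ac)
  qed
  from this[OF zs, of "[]"] have eq: "(\<integral>x. h zs x \<partial>P) = (\<integral>x. h zs x \<partial>Q)" by simp
  define S where "S = {x \<in> space N. \<forall>(i, r) \<in> set zs. r < g i x}"
  have h: "h zs x = indicator S x" if "x \<in> space N" for x
  proof -
    have "h zs x = (if \<forall>(i, r) \<in> set zs. r < g i x then 1 else 0)"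
      unfolding h_def by (induction zs) auto
    then show ?thesis using that by (simp add: S_def indicator_def)
  qed
  have "S = {x \<in> space N. h zs x \<noteq> 0}"
    using h by (auto simp: S_def indicator_def)
  also have "\<dots> \<in> sets N"
    using mh[OF zs] by measurable
  finally have S: "S \<in> sets N" .
  have "(\<integral>x. h zs x \<partial>L) = measure L S" if "sets L = sets N" for L
  proof -
    have L: "space L = space N" using that by (rule sets_eq_imp_space_eq)
    have "(\<integral>x. h zs x \<partial>L) = (\<integral>x. indicator S x \<partial>L)"
      using h by (intro Bochner_Integration.integral_cong) (auto simp: L)
    then show ?thesis
      using sets.sets_into_space[OF S] by (simp add: L Int_absorb2)
  qed
  with eq show ?thesis
    by (simp add: S_def[symmetric] P(2) Q(2) P.emeasure_eq_measure Q.emeasure_eq_measure)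
qed

subsection \<open>Energy kernels\<close>

text \<open>Openness is spelled out because \<open>\<delta>\<close> need not be a metric. For a
  squared metric these are the open sets of the metric itself, since only the radii change.\<close>

definition kernel_open :: "'a set \<Rightarrow> ('a \<Rightarrow> 'a \<Rightarrow> real) \<Rightarrow> 'a set \<Rightarrow> bool" where
  "kernel_open S \<delta> U \<longleftrightarrow> U \<subseteq> S \<and> (\<forall>x\<in>U. \<exists>r>0. \<forall>y\<in>S. \<delta> x y < r \<longrightarrow> y \<in> U)"

text \<open>
  The relaxed triangle inequality holds for squares of metrics as well as for metrics, and it
  passes to sums.
\<close>

locale energy_kernel =
  fixes N :: "'a measure" and \<delta> :: "'a \<Rightarrow> 'a \<Rightarrow> real"
  assumes sym: "\<And>x y. x \<in> space N \<Longrightarrow> y \<in> space N \<Longrightarrow> \<delta> x y = \<delta> y x"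
    and nonneg: "\<And>x y. x \<in> space N \<Longrightarrow> y \<in> space N \<Longrightarrow> 0 \<le> \<delta> x y"
    and self: "\<And>x. x \<in> space N \<Longrightarrow> \<delta> x x = 0"
    and quasi_triangle: "\<And>x y z. x \<in> space N \<Longrightarrow> y \<in> space N \<Longrightarrow> z \<in> space N \<Longrightarrow>
      \<delta> x z \<le> 2 * (\<delta> x y + \<delta> y z)"
    and negative: "conditionally_negative (space N) \<delta>"
    and measurable_kernel: "case_prod \<delta> \<in> borel_measurable (N \<Otimes>\<^sub>M N)"
    and dense: "\<exists>C. countable C \<and> C \<subseteq> space N \<and> (\<forall>x\<in>space N. \<forall>e>0. \<exists>c\<in>C. \<delta> x c < e)"
    and generated: "sets N \<subseteq> sigma_sets (space N) {U. kernel_open (space N) \<delta> U}"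
begin

declare measurable_kernel [measurable]

lemma measurable_kernel_section: "y \<in> space N \<Longrightarrow> (\<lambda>x. \<delta> x y) \<in> borel_measurable N"
  by measurable

text \<open>A countable dense set makes every such set a countable union of balls with rational
  radii.\<close>

lemma kernel_open_in_balls:
  assumes "kernel_open (space N) \<delta> U"
  shows "U \<in> sigma_sets (space N) {{x \<in> space N. \<delta> x y < r} | y r. y \<in> space N}"
proof -
  obtain C where C: "countable C" "C \<subseteq> space N" "\<And>x e. x \<in> space N \<Longrightarrow> e > 0 \<Longrightarrow> \<exists>c\<in>C. \<delta> x c < e"
    using dense by blast
  define K where "K = {(c, q) \<in> C \<times> \<rat>. {x \<in> space N. \<delta> x c < q} \<subseteq> U}"
  have "countable K"
    by (rule countable_subset[of _ "C \<times> \<rat>"]) (auto simp: K_def C countable_rat)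
  have U: "U \<subseteq> space N" using assms by (simp add: kernel_open_def)
  have "U = (\<Union>(c, q)\<in>K. {x \<in> space N. \<delta> x c < q})"
  proof (intro equalityI subsetI)
    fix x assume x: "x \<in> U"
    then obtain r where r: "r > 0" "\<And>y. y \<in> space N \<Longrightarrow> \<delta> x y < r \<Longrightarrow> y \<in> U"
      using assms by (auto simp: kernel_open_def)
    have xN: "x \<in> space N" using x U by auto
    \<comment> \<open>The relaxed triangle inequality costs a factor 2 on a sum of two terms, hence
      a quarter of the radius.\<close>
    then obtain c where c: "c \<in> C" "\<delta> x c < r / 4"
      using C(3)[of x "r / 4"] r by auto
    obtain q where q: "q \<in> \<rat>" "\<delta> x c < q" "q < r / 4"
      using Rats_dense_in_real[OF c(2)] by auto
    have cN: "c \<in> space N" using c C by auto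
    have "y \<in> U" if y: "y \<in> space N" "\<delta> y c < q" for y
    proof (rule r(2)[OF y(1)])
      have "\<delta> x y \<le> 2 * (\<delta> x c + \<delta> c y)" using quasi_triangle xN cN y by blast
      then show "\<delta> x y < r" using sym[OF cN y(1)] y(2) q c by argo
    qed
    then have "(c, q) \<in> K" using c q by (auto simp: K_def)
    then show "x \<in> (\<Union>(c, q)\<in>K. {x \<in> space N. \<delta> x c < q})" using q xN by auto
  qed (auto simp: K_def)
  also have "\<dots> \<in> sigma_sets (space N) {{x \<in> space N. \<delta> x y < r} | y r. y \<in> space N}"
    using \<open>countable K\<close> C(2)
    by (intro sigma_sets_UNION countable_image) (auto simp: K_def intro!: sigma_sets.Basic)
  finally show ?thesis .
qed

text \<open>Finite intersections of balls form a pi-system: lists of centres and radii are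
  intersected by appending, and the empty list gives the whole space. Agreement on single balls is
  too weak, as there are metric spaces with distinct probability measures that agree on all
  balls.\<close>

lemma measure_eqI_ball_intersections:
  assumes P: "prob_space P" "sets P = sets N" and Q: "prob_space Q" "sets Q = sets N"
    and eq: "\<And>zs. fst ` set zs \<subseteq> space N \<Longrightarrow>
      emeasure P {x \<in> space N. \<forall>(y, r) \<in> set zs. \<delta> x y < r} =
      emeasure Q {x \<in> space N. \<forall>(y, r) \<in> set zs. \<delta> x y < r}"
  shows "P = Q"
proof -
  interpret P: prob_space P by fact
  let ?B = "\<lambda>zs. {x \<in> space N. \<forall>(y, r) \<in> set zs. \<delta> x y < r}"
  let ?E = "{?B zs | zs. fst ` set zs \<subseteq> space N}"
  have "sigma_sets (space N) ?E \<subseteq> sets N"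
  proof (rule sets.sigma_sets_subset, rule subsetI)
    fix A assume "A \<in> ?E"
    then obtain zs where A: "A = ?B zs" and zs: "fst ` set zs \<subseteq> space N" by blast
    have "(\<lambda>x. \<delta> x (fst z)) \<in> borel_measurable N" if "z \<in> set zs" for z
      using zs that by (intro measurable_kernel_section) auto
    note [measurable] = this
    have "?B zs = {x \<in> space N. \<forall>z\<in>set zs. \<delta> x (fst z) < snd z}" by auto
    also have "\<dots> \<in> sets N" by measurable
    finally show "A \<in> sets N" using A by simp
  qed
  moreover have "sets N \<subseteq> sigma_sets (space N) ?E"
  proof -
    have "sigma_sets (space N) {{x \<in> space N. \<delta> x y < r} | y r. y \<in> space N} \<subseteq> sigma_sets (space N) ?E"
    proof (rule sigma_sets_mono', rule subsetI)
      fix A assume "A \<in> {{x \<in> space N. \<delta> x y < r} | y r. y \<in> space N}"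
      then obtain y r where "y \<in> space N" "A = {x \<in> space N. \<delta> x y < r}" by blast
      then show "A \<in> ?E" by (intro CollectI exI[of _ "[(y, r)]"]) auto
    qed
    then show ?thesis
      using generated kernel_open_in_balls
        sigma_sets_mono[of "{U. kernel_open (space N) \<delta> U}" "space N" "?E"] by blast
  qed
  ultimately have sets: "sets N = sigma_sets (space N) ?E" by blast
  show ?thesis
  proof (rule measure_eqI_generator_eq[where A="\<lambda>_. space N" and E="?E" and \<Omega>="space N"])
    show "Int_stable ?E"
    proof (rule Int_stableI)
      fix A B assume "A \<in> ?E" "B \<in> ?E"
      then obtain zs zs' where z: "A = ?B zs" "B = ?B zs'" "fst ` set zs \<subseteq> space N" "fst ` set zs' \<subseteq> space N"
        by blast
      then have "A \<inter> B = ?B (zs @ zs')" "fst ` set (zs @ zs') \<subseteq> space N" by auto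
      then show "A \<inter> B \<in> ?E" by blast
    qed
    show "?E \<subseteq> Pow (space N)" by auto
    show "emeasure P A = emeasure Q A" if "A \<in> ?E" for A
      using that eq by blast
    show "range (\<lambda>_. space N) \<subseteq> ?E" by (auto intro!: exI[of _ "[]"])
  qed (use P Q sets in auto)
qed

text \<open>The right side is the energy of P - Q at the scale \<open>sqrt (card L * a)\<close>. The
  factor \<open>a\<close> serves two purposes: \<open>a = s\<^sup>2\<close> with one point shows
  that the energy at scale s is nonnegative, and \<open>a = 1\<close> with many points controls
  products.\<close>

lemma gaussian_mmd_ge:
  assumes P: "prob_space P" "sets P = sets N" and Q: "prob_space Q" "sets Q = sets N"
    and "a \<ge> 0" and L: "finite L" "L \<noteq> {}" "y ` L \<subseteq> space N"
  shows "((\<integral>x. exp (- (\<Sum>l\<in>L. a * \<delta> x (y l))) \<partial>P) - (\<integral>x. exp (- (\<Sum>l\<in>L. a * \<delta> x (y l))) \<partial>Q))\<^sup>2 \<le>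
    (\<integral>z. exp (- (card L * (a * case_prod \<delta> z))) \<partial>(P \<Otimes>\<^sub>M P)) +
    (\<integral>z. exp (- (card L * (a * case_prod \<delta> z))) \<partial>(Q \<Otimes>\<^sub>M Q)) -
    2 * (\<integral>z. exp (- (card L * (a * case_prod \<delta> z))) \<partial>(P \<Otimes>\<^sub>M Q))"
proof -
  have [measurable]: "(\<lambda>x. \<delta> x (y l)) \<in> borel_measurable N" if "l \<in> L" for l
    using L that by (intro measurable_kernel_section) auto
  have neg: "conditionally_negative (space N) (\<lambda>x y. a * \<delta> x y)"
    using negative \<open>a \<ge> 0\<close> unfolding conditionally_negative_def
    by (auto simp: mult.left_commute[of _ a] sum_distrib_left[symmetric] mult_nonneg_nonpos)
  have "((\<integral>x. exp (- (\<Sum>l\<in>L. a * \<delta> x (y l))) \<partial>P) - (\<integral>x. exp (- (\<Sum>l\<in>L. a * \<delta> x (y l))) \<partial>Q))\<^sup>2 \<le>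
     (\<integral>z. (case z of (x, y) \<Rightarrow> exp (- (card L * (a * \<delta> x y)))) \<partial>(P \<Otimes>\<^sub>M P)) +
     (\<integral>z. (case z of (x, y) \<Rightarrow> exp (- (card L * (a * \<delta> x y)))) \<partial>(Q \<Otimes>\<^sub>M Q)) -
     2 * (\<integral>z. (case z of (x, y) \<Rightarrow> exp (- (card L * (a * \<delta> x y)))) \<partial>(P \<Otimes>\<^sub>M Q))"
  proof (rule integral_kernel_diff_ge[OF P Q])
    fix I :: "(nat + nat) set" and x c assume "finite I" "\<And>i. i \<in> I \<Longrightarrow> x i \<in> space N"
    then show "(\<Sum>i\<in>I. c i * exp (- (\<Sum>l\<in>L. a * \<delta> (x i) (y l))))\<^sup>2
         \<le> (\<Sum>i\<in>I. \<Sum>j\<in>I. c i * c j * exp (- (card L * (a * \<delta> (x i) (x j)))))"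
      using L \<open>a \<ge> 0\<close> nonneg sym by (intro Schoenberg_gaussian_ge[OF neg]) auto
  next
    show "\<bar>exp (- (\<Sum>l\<in>L. a * \<delta> x (y l)))\<bar> \<le> 1" if "x \<in> space N" for x
      using L that \<open>a \<ge> 0\<close> nonneg by (auto intro!: sum_nonneg mult_nonneg_nonneg)
  qed (use \<open>a \<ge> 0\<close> nonneg sym in auto)
  then show ?thesis by (simp add: split_beta)
qed

theorem energy_zero_imp_eq:
  assumes P: "prob_space P" "sets P = sets N" and Q: "prob_space Q" "sets Q = sets N"
    and int: "integrable (P \<Otimes>\<^sub>M P) (\<lambda>z. sqrt (case_prod \<delta> z))"
      "integrable (Q \<Otimes>\<^sub>M Q) (\<lambda>z. sqrt (case_prod \<delta> z))"
      "integrable (P \<Otimes>\<^sub>M Q) (\<lambda>z. sqrt (case_prod \<delta> z))"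
    and zero: "2 * (\<integral>z. sqrt (case_prod \<delta> z) \<partial>(P \<Otimes>\<^sub>M Q)) - (\<integral>z. sqrt (case_prod \<delta> z) \<partial>(P \<Otimes>\<^sub>M P)) -
      (\<integral>z. sqrt (case_prod \<delta> z) \<partial>(Q \<Otimes>\<^sub>M Q)) = 0"
  shows "P = Q"
proof -
  interpret P: prob_space P by fact
  interpret Q: prob_space Q by fact
  interpret PP: pair_prob_space P P ..
  interpret QQ: pair_prob_space Q Q ..
  interpret PQ: pair_prob_space P Q ..
  note [measurable_cong] = P(2) Q(2)
  have sp: "space P = space N" "space Q = space N"
    using P(2) Q(2) by (auto dest: sets_eq_imp_space_eq)
  define \<Phi> where "\<Phi> L s = (\<integral>z. exp (- (s\<^sup>2 * case_prod \<delta> z)) \<partial>L)" for L :: "('a \<times> 'a) measure" and s :: real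
  have \<Phi>: "continuous_on UNIV (\<Phi> L)" "\<Phi> L 0 = 1" "integrable lborel (\<lambda>s. (1 - \<Phi> L s) / s\<^sup>2)"
      "(\<integral>s. (1 - \<Phi> L s) / s\<^sup>2 \<partial>lborel) = sqrt_const * (\<integral>z. sqrt (case_prod \<delta> z) \<partial>L)"
    if "prob_space L" "sets L = sets (N \<Otimes>\<^sub>M N)" "integrable L (\<lambda>z. sqrt (case_prod \<delta> z))" for L
  proof -
    interpret L: prob_space L by fact
    have m: "case_prod \<delta> \<in> borel_measurable L"
      using measurable_kernel that(2) by (simp cong: measurable_cong_sets)
    have nn: "0 \<le> case_prod \<delta> z" if "z \<in> space L" for z
      using that sets_eq_imp_space_eq[OF \<open>sets L = _\<close>] nonneg by (auto simp: space_pair_measure)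
    show "continuous_on UNIV (\<Phi> L)" unfolding \<Phi>_def
      by (rule continuous_expectation_gaussian[OF that(1) m nn])
    show "\<Phi> L 0 = 1" by (simp add: \<Phi>_def L.prob_space)
    show "integrable lborel (\<lambda>s. (1 - \<Phi> L s) / s\<^sup>2)" unfolding \<Phi>_def
      by (rule expectation_sqrt_gaussian(1)[OF that(1) m nn that(3)])
    show "(\<integral>s. (1 - \<Phi> L s) / s\<^sup>2 \<partial>lborel) = sqrt_const * (\<integral>z. sqrt (case_prod \<delta> z) \<partial>L)" unfolding \<Phi>_def
      by (rule expectation_sqrt_gaussian(2)[OF that(1) m nn that(3)])
  qed
  have s: "sets (P \<Otimes>\<^sub>M P) = sets (N \<Otimes>\<^sub>M N)" "sets (Q \<Otimes>\<^sub>M Q) = sets (N \<Otimes>\<^sub>M N)" "sets (P \<Otimes>\<^sub>M Q) = sets (N \<Otimes>\<^sub>M N)"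
    by (intro sets_pair_measure_cong P Q)+
  note PP = \<Phi>[OF PP.prob_space_axioms s(1) int(1)]
  note QQ = \<Phi>[OF QQ.prob_space_axioms s(2) int(2)]
  note PQ = \<Phi>[OF PQ.prob_space_axioms s(3) int(3)]
  define G where "G s = \<Phi> (P \<Otimes>\<^sub>M P) s + \<Phi> (Q \<Otimes>\<^sub>M Q) s - 2 * \<Phi> (P \<Otimes>\<^sub>M Q) s" for s
  have bound: "((\<integral>x. exp (- (\<Sum>l\<in>L. a * \<delta> x (y l))) \<partial>P) - (\<integral>x. exp (- (\<Sum>l\<in>L. a * \<delta> x (y l))) \<partial>Q))\<^sup>2 \<le>
      G (sqrt (card L * a))" if "a \<ge> 0" "finite L" "L \<noteq> {}" "y ` L \<subseteq> space N" for a :: real and L :: "nat set" and y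
    using gaussian_mmd_ge[OF P Q that(1-4)] \<open>a \<ge> 0\<close> by (simp add: G_def \<Phi>_def mult.assoc)
  obtain x0 where x0: "x0 \<in> space N" using P.not_empty sp by auto
  have G_nonneg: "G s \<ge> 0" for s
  proof -
    have "0 \<le> ((\<integral>x. exp (- (\<Sum>l\<in>{0::nat}. s\<^sup>2 * \<delta> x x0)) \<partial>P) - (\<integral>x. exp (- (\<Sum>l\<in>{0::nat}. s\<^sup>2 * \<delta> x x0)) \<partial>Q))\<^sup>2" by simp
    also have "\<dots> \<le> G (sqrt (s\<^sup>2))"
      using bound[of "s\<^sup>2" "{0}" "\<lambda>_. x0"] x0 by simp
    also have "\<dots> = G s" by (simp add: G_def \<Phi>_def)
    finally show ?thesis .
  qed
  \<comment> \<open>The combination whose integral is \<open>sqrt_const\<close> times the energy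
    distance. The three constants 1 cancel, because 2 - 1 - 1 = 0, and leave the energy
    \<open>G s\<close> over \<open>s\<^sup>2\<close>.\<close>
  define H where "H s = 2 * ((1 - \<Phi> (P \<Otimes>\<^sub>M Q) s) / s\<^sup>2) - (1 - \<Phi> (P \<Otimes>\<^sub>M P) s) / s\<^sup>2 - (1 - \<Phi> (Q \<Otimes>\<^sub>M Q) s) / s\<^sup>2" for s
  have H: "H s = G s / s\<^sup>2" for s
    by (simp add: H_def G_def add_divide_distrib diff_divide_distrib)
  let ?I = "\<lambda>L. \<integral>z. sqrt (case_prod \<delta> z) \<partial>L"
  have "has_bochner_integral lborel H (2 * (sqrt_const * ?I (P \<Otimes>\<^sub>M Q)) - sqrt_const * ?I (P \<Otimes>\<^sub>M P) - sqrt_const * ?I (Q \<Otimes>\<^sub>M Q))"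
    unfolding H_def using PP(3,4) QQ(3,4) PQ(3,4)
    by (intro has_bochner_integral_diff has_bochner_integral_mult_right) (auto simp: has_bochner_integral_iff)
  also have "\<dots> = sqrt_const * (2 * ?I (P \<Otimes>\<^sub>M Q) - ?I (P \<Otimes>\<^sub>M P) - ?I (Q \<Otimes>\<^sub>M Q))"
    by (simp add: algebra_simps)
  finally have "integrable lborel H" "(\<integral>s. H s \<partial>lborel) = 0"
    by (simp_all add: zero has_bochner_integral_iff)
  then have "AE s in lborel. H s = 0"
    by (subst (asm) integral_nonneg_eq_0_iff_AE) (auto simp: H G_nonneg)
  then have "AE s in lborel. G s = 0"
  proof eventually_elim
    case (elim s)
    \<comment> \<open>At s = 0 the quotient carries no information, but \<open>G 0\<close> is 1 + 1
      - 2.\<close>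
    then show ?case using PP(2) QQ(2) PQ(2) by (cases "s = 0") (auto simp: H G_def)
  qed
  moreover have "continuous_on UNIV G"
    unfolding G_def by (intro continuous_intros PP QQ PQ)
  ultimately have G0: "G s = 0" for s
    by (intro continuous_AE_zero_imp_zero)
  have prod_eq: "(\<integral>x. (\<Prod>y\<leftarrow>ys. exp (- \<delta> x y)) \<partial>P) = (\<integral>x. (\<Prod>y\<leftarrow>ys. exp (- \<delta> x y)) \<partial>Q)"
    if ys: "set ys \<subseteq> space N" for ys
  proof (cases "ys = []")
    case True
    then show ?thesis by (simp add: P.prob_space Q.prob_space)
  next
    case False
    have "(\<Prod>y\<leftarrow>ys. exp (- \<delta> x y)) = exp (- (\<Sum>y\<leftarrow>ys. \<delta> x y))" for x
      by (induction ys) (auto simp flip: exp_add)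
    \<comment> \<open>The sum runs over positions, not over the set of points, so that repeated
      points are counted with multiplicity.\<close>
    then have eq: "(\<Prod>y\<leftarrow>ys. exp (- \<delta> x y)) = exp (- (\<Sum>l\<in>{..<length ys}. 1 * \<delta> x (ys ! l)))" for x
      by (simp add: sum_list_sum_nth lessThan_atLeast0)
    have "((\<integral>x. (\<Prod>y\<leftarrow>ys. exp (- \<delta> x y)) \<partial>P) - (\<integral>x. (\<Prod>y\<leftarrow>ys. exp (- \<delta> x y)) \<partial>Q))\<^sup>2 \<le> 0"
      using bound[of 1 "{..<length ys}" "\<lambda>l. ys ! l"] False ys nth_mem[of _ ys] unfolding eq G0
      by (fastforce simp: lessThan_empty_iff)
    then show ?thesis by simp
  qed
  show ?thesis
  proof (rule measure_eqI_ball_intersections[OF P Q])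
    fix zs :: "('a \<times> real) list" assume zs: "fst ` set zs \<subseteq> space N"
    show "emeasure P {x \<in> space N. \<forall>(y, r) \<in> set zs. \<delta> x y < r} =
      emeasure Q {x \<in> space N. \<forall>(y, r) \<in> set zs. \<delta> x y < r}"
    proof -
      \<comment> \<open>A ball of radius r is the superlevel set of
        \<open>exp (- \<delta> x y)\<close> at \<open>exp (- r)\<close>, and this function takes
        values in the unit interval.\<close>
      have "emeasure P {x \<in> space N. \<forall>(y, r) \<in> set (map (\<lambda>(y, r). (y, exp (- r))) zs). r < exp (- \<delta> x y)} =
        emeasure Q {x \<in> space N. \<forall>(y, r) \<in> set (map (\<lambda>(y, r). (y, exp (- r))) zs). r < exp (- \<delta> x y)}"
      proof (rule product_moments_determine_superlevel_sets[OF P Q, where J="space N"])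
        show "(\<lambda>x. exp (- \<delta> x y)) \<in> borel_measurable N" if "y \<in> space N" for y
          using measurable_kernel_section[OF that] by measurable
      qed (use zs nonneg prod_eq in auto)
      then show ?thesis by (simp add: split_beta)
    qed
  qed
qed

end

subsection \<open>Products and examples of energy kernels\<close>

text \<open>Case S2 prescribes the kernels only on \<open>eucl_space\<close>, not on all functions
  of the type.\<close>

lemma energy_kernel_cong:
  assumes "energy_kernel N \<delta>" and eq: "\<And>x y. x \<in> space N \<Longrightarrow> y \<in> space N \<Longrightarrow> \<delta>' x y = \<delta> x y"
  shows "energy_kernel N \<delta>'"
proof -
  interpret energy_kernel N \<delta> by fact
  show ?thesis
  proof
    show "conditionally_negative (space N) \<delta>'"
      unfolding conditionally_negative_def
    proof (intro allI impI)
      fix n x and \<alpha> :: "nat \<Rightarrow> real"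
      assume "n \<ge> 1" "x ` {1..n} \<subseteq> space N" "sum \<alpha> {1..n} = 0"
      moreover from this(2) have "(\<Sum>i=1..n. \<Sum>j=1..n. \<alpha> i * \<alpha> j * \<delta>' (x i) (x j)) =
          (\<Sum>i=1..n. \<Sum>j=1..n. \<alpha> i * \<alpha> j * \<delta> (x i) (x j))"
        by (intro sum.cong refl) (auto simp: eq image_subset_iff)
      ultimately show "(\<Sum>i=1..n. \<Sum>j=1..n. \<alpha> i * \<alpha> j * \<delta>' (x i) (x j)) \<le> 0"
        using negative by (simp add: conditionally_negative_def)
    qed
    show "case_prod \<delta>' \<in> borel_measurable (N \<Otimes>\<^sub>M N)"
      using measurable_kernel
      by (rule measurable_cong[THEN iffD1, rotated]) (auto simp: space_pair_measure eq)
    have "kernel_open (space N) \<delta>' U \<longleftrightarrow> kernel_open (space N) \<delta> U" for U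
      by (auto simp: kernel_open_def eq subset_iff)
    then show "sets N \<subseteq> sigma_sets (space N) {U. kernel_open (space N) \<delta>' U}"
      using generated by simp
    obtain C where "countable C" "C \<subseteq> space N" "\<forall>x\<in>space N. \<forall>e>0. \<exists>c\<in>C. \<delta> x c < e"
      using dense by blast
    then show "\<exists>C. countable C \<and> C \<subseteq> space N \<and> (\<forall>x\<in>space N. \<forall>e>0. \<exists>c\<in>C. \<delta>' x c < e)"
      by (intro exI[of _ C]) (auto simp: eq subset_iff)
  qed (use sym nonneg self quasi_triangle in \<open>auto simp: eq\<close>)
qed

text \<open>This serves at two levels: it assembles the squared Euclidean distance from single
  coordinates, and the kernel \<open>D\<close> from the groups.\<close>

lemma energy_kernel_PiM:
  fixes N :: "'i \<Rightarrow> 'b measure"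
  assumes "finite I" and kernels: "\<And>i. i \<in> I \<Longrightarrow> energy_kernel (N i) (\<delta> i)"
  shows "energy_kernel (PiM I N) (\<lambda>x y. \<Sum>i\<in>I. \<delta> i (x i) (y i))" (is "energy_kernel ?N ?\<delta>")
proof
  note K = energy_kernel.sym[OF kernels] energy_kernel.nonneg[OF kernels] energy_kernel.self[OF kernels]
    energy_kernel.quasi_triangle[OF kernels]
  have mem: "x i \<in> space (N i)" if "x \<in> space ?N" "i \<in> I" for x i
    using that by (auto simp: space_PiM)
  fix x y z assume x: "x \<in> space ?N" and y: "y \<in> space ?N" and z: "z \<in> space ?N"
  show "?\<delta> x y = ?\<delta> y x" using x y by (intro sum.cong refl K) (auto intro: mem)
  show "?\<delta> x y \<ge> 0" using x y by (intro sum_nonneg K) (auto intro: mem)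
  show "?\<delta> x x = 0" using x by (intro sum.neutral ballI K) (auto intro: mem)
  show "?\<delta> x z \<le> 2 * (?\<delta> x y + ?\<delta> y z)"
    unfolding sum.distrib[symmetric] sum_distrib_left
    using x y z by (intro sum_mono K) (auto intro: mem)
next
  have mem: "x i \<in> space (N i)" if "x \<in> space ?N" "i \<in> I" for x i
    using that by (auto simp: space_PiM)
  show "conditionally_negative (space ?N) ?\<delta>"
    unfolding conditionally_negative_def
  proof (intro allI impI)
    fix n x and \<alpha> :: "nat \<Rightarrow> real"
    assume n: "n \<ge> 1" and x: "x ` {1..n} \<subseteq> space ?N" and \<alpha>: "sum \<alpha> {1..n} = 0"
    have "(\<Sum>k=1..n. \<Sum>l=1..n. \<alpha> k * \<alpha> l * ?\<delta> (x k) (x l)) =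
        (\<Sum>k=1..n. \<Sum>i\<in>I. \<Sum>l=1..n. \<alpha> k * \<alpha> l * \<delta> i (x k i) (x l i))"
      unfolding sum_distrib_left by (intro sum.cong refl sum.swap)
    also have "\<dots> = (\<Sum>i\<in>I. \<Sum>k=1..n. \<Sum>l=1..n. \<alpha> k * \<alpha> l * \<delta> i (x k i) (x l i))"
      by (rule sum.swap)
    also have "\<dots> \<le> 0"
    proof (rule sum_nonpos)
      fix i assume i: "i \<in> I"
      have "(\<lambda>k. x k i) ` {1..n} \<subseteq> space (N i)"
        using x i mem by (auto simp: image_subset_iff)
      then show "(\<Sum>k=1..n. \<Sum>l=1..n. \<alpha> k * \<alpha> l * \<delta> i (x k i) (x l i)) \<le> 0"
        using conditionally_negativeD[OF energy_kernel.negative[OF kernels[OF i]], of "{1..n}" "\<lambda>k. x k i" \<alpha>] \<alpha>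
        by simp
    qed
    finally show "(\<Sum>k=1..n. \<Sum>l=1..n. \<alpha> k * \<alpha> l * ?\<delta> (x k) (x l)) \<le> 0" .
  qed
  have "(\<lambda>z. \<delta> i (fst z i) (snd z i)) \<in> borel_measurable (?N \<Otimes>\<^sub>M ?N)" if i: "i \<in> I" for i
  proof -
    note [measurable] = energy_kernel.measurable_kernel[OF kernels[OF i]]
    have [measurable]: "(\<lambda>x. x i) \<in> ?N \<rightarrow>\<^sub>M N i" using i by (rule measurable_component_singleton)
    show ?thesis by measurable
  qed
  then have "(\<lambda>z. \<Sum>i\<in>I. \<delta> i (fst z i) (snd z i)) \<in> borel_measurable (?N \<Otimes>\<^sub>M ?N)"
    by (rule borel_measurable_sum)
  then show "(\<lambda>(x, y). ?\<delta> x y) \<in> borel_measurable (?N \<Otimes>\<^sub>M ?N)"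
    by (simp add: split_beta')
  have "\<forall>i\<in>I. \<exists>C. countable C \<and> C \<subseteq> space (N i) \<and> (\<forall>x\<in>space (N i). \<forall>e>0. \<exists>c\<in>C. \<delta> i x c < e)"
    using energy_kernel.dense[OF kernels] by blast
  then obtain C where "\<forall>i\<in>I. countable (C i) \<and> C i \<subseteq> space (N i) \<and> (\<forall>x\<in>space (N i). \<forall>e>0. \<exists>c\<in>C i. \<delta> i x c < e)"
    unfolding bchoice_iff by blast
  then have C: "\<And>i. i \<in> I \<Longrightarrow> countable (C i)" "\<And>i. i \<in> I \<Longrightarrow> C i \<subseteq> space (N i)"
      "\<And>i x e. i \<in> I \<Longrightarrow> x \<in> space (N i) \<Longrightarrow> e > 0 \<Longrightarrow> \<exists>c\<in>C i. \<delta> i x c < e"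
    by blast+
  show "\<exists>C. countable C \<and> C \<subseteq> space ?N \<and> (\<forall>x\<in>space ?N. \<forall>e>0. \<exists>c\<in>C. ?\<delta> x c < e)"
  proof (intro exI conjI ballI allI impI)
    show "countable (PiE I C)" using \<open>finite I\<close> C(1) by (rule countable_PiE)
    show "PiE I C \<subseteq> space ?N" unfolding space_PiM using C(2) by (rule PiE_mono)
    fix x and e :: real assume x: "x \<in> space ?N" and e: "e > 0"
    \<comment> \<open>The added 1 covers an empty index set and makes the final inequality
      strict.\<close>
    define e' where "e' = e / (real (card I) + 1)"
    have "e' > 0" using e by (simp add: e'_def)
    then have "\<forall>i\<in>I. \<exists>c\<in>C i. \<delta> i (x i) c < e'"
      using C(3) mem[OF x] by blast
    then obtain c where "\<forall>i\<in>I. c i \<in> C i \<and> \<delta> i (x i) (c i) < e'"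
      unfolding Bex_def bchoice_iff by blast
    then have c: "\<And>i. i \<in> I \<Longrightarrow> c i \<in> C i" "\<And>i. i \<in> I \<Longrightarrow> \<delta> i (x i) (c i) < e'"
      by blast+
    have "?\<delta> x (restrict c I) \<le> (\<Sum>i\<in>I. e')"
      using c by (intro sum_mono) (auto intro: less_imp_le)
    also have "\<dots> = real (card I) * e'" by simp
    also have "\<dots> < (real (card I) + 1) * e'" using \<open>e' > 0\<close> by simp
    also have "\<dots> = e"
      using e by (simp add: e'_def add_nonneg_eq_0_iff)
    finally have "?\<delta> x (restrict c I) < e" .
    then show "\<exists>c\<in>PiE I C. ?\<delta> x c < e"
      using c(1) by (intro bexI[of _ "restrict c I"]) auto
  qed
  let ?O = "sigma_sets (space ?N) {U. kernel_open (space ?N) ?\<delta> U}"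
  \<comment> \<open>Each summand is at most the whole sum, so a cylinder over an open base is open
    for the sum; preimages under a coordinate respect complements and countable unions, which
    handles the rest of the sigma-algebra.\<close>
  have cyl: "{f \<in> space ?N. f i \<in> A} \<in> ?O"
    if i: "i \<in> I" and A: "A \<in> sigma_sets (space (N i)) {U. kernel_open (space (N i)) (\<delta> i) U}" for i A
    using A
  proof induction
    case (Basic U)
    have "kernel_open (space ?N) ?\<delta> {f \<in> space ?N. f i \<in> U}"
      unfolding kernel_open_def
    proof (intro conjI ballI)
      fix x assume x: "x \<in> {f \<in> space ?N. f i \<in> U}"
      then obtain r where r: "r > 0" "\<And>y. y \<in> space (N i) \<Longrightarrow> \<delta> i (x i) y < r \<Longrightarrow> y \<in> U"
        using Basic by (auto simp: kernel_open_def)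
      have "y i \<in> U" if y: "y \<in> space ?N" "?\<delta> x y < r" for y
      proof (rule r(2))
        have "\<delta> i (x i) (y i) \<le> ?\<delta> x y"
          using x y i \<open>finite I\<close> mem energy_kernel.nonneg[OF kernels]
          by (intro member_le_sum) auto
        then show "\<delta> i (x i) (y i) < r" using y by simp
      qed (use mem y i in auto)
      then show "\<exists>r>0. \<forall>y\<in>space ?N. ?\<delta> x y < r \<longrightarrow> y \<in> {f \<in> space ?N. f i \<in> U}"
        using r(1) by auto
    qed auto
    then show ?case by (intro sigma_sets.Basic) simp
  next
    case Empty
    then show ?case by (simp add: sigma_sets.Empty)
  next
    case (Compl A)
    have "{f \<in> space ?N. f i \<in> space (N i) - A} = space ?N - {f \<in> space ?N. f i \<in> A}"
      using mem i by auto
    then show ?case using sigma_sets.Compl[OF Compl.IH] by simp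
  next
    case (Union A)
    have "{f \<in> space ?N. f i \<in> (\<Union>n. A n)} = (\<Union>n. {f \<in> space ?N. f i \<in> A n})" by auto
    then show ?case using sigma_sets.Union[OF Union.IH] by simp
  qed
  show "sets ?N \<subseteq> ?O"
    unfolding sets_PiM_single space_PiM[symmetric]
  proof (rule sigma_sets_mono, rule subsetI)
    fix A assume "A \<in> {{f \<in> space ?N. f i \<in> A} | i A. i \<in> I \<and> A \<in> sets (N i)}"
    then obtain i B where "i \<in> I" "B \<in> sets (N i)" "A = {f \<in> space ?N. f i \<in> B}" by blast
    then show "A \<in> ?O"
      using cyl[of i B] energy_kernel.generated[OF kernels, of i] by auto
  qed
qed

lemma energy_kernel_real: "energy_kernel borel (\<lambda>x y :: real. (x - y)\<^sup>2)"
proof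
  fix x y z :: real
  show "(x - y)\<^sup>2 = (y - x)\<^sup>2" by (rule power2_commute)
  \<comment> \<open>Squares satisfy the triangle inequality only up to the factor 2, and here lies
    the origin of that factor in \<open>quasi_triangle\<close>.\<close>
  have "0 \<le> ((x - y) - (y - z))\<^sup>2" by simp
  then show "(x - z)\<^sup>2 \<le> 2 * ((x - y)\<^sup>2 + (y - z)\<^sup>2)"
    by (simp add: power2_eq_square algebra_simps)
next
  show "conditionally_negative (space borel) (\<lambda>x y :: real. (x - y)\<^sup>2)"
    unfolding conditionally_negative_def
  proof (intro allI impI)
    fix n and x \<alpha> :: "nat \<Rightarrow> real" assume "sum \<alpha> {1..n} = 0"
    let ?I = "{1..n}" and ?q = "\<lambda>i. \<alpha> i * (x i)\<^sup>2"
    have "(\<Sum>i\<in>?I. \<Sum>j\<in>?I. \<alpha> i * \<alpha> j * (x i - x j)\<^sup>2) =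
       (\<Sum>i\<in>?I. \<Sum>j\<in>?I. ?q i * \<alpha> j) + (\<Sum>i\<in>?I. \<Sum>j\<in>?I. \<alpha> i * ?q j) -
       2 * (\<Sum>i\<in>?I. \<Sum>j\<in>?I. (\<alpha> i * x i) * (\<alpha> j * x j))"
      unfolding sum_distrib_left sum.distrib[symmetric] sum_subtractf[symmetric]
      by (intro sum.cong refl) (simp add: power2_eq_square algebra_simps)
    \<comment> \<open>The two mixed terms contain the total weight as a factor and vanish.\<close>
    also have "\<dots> = - 2 * (\<Sum>i\<in>?I. \<alpha> i * x i)\<^sup>2"
      unfolding sum_product[symmetric] \<open>sum \<alpha> {1..n} = 0\<close> by (simp add: power2_eq_square)
    also have "\<dots> \<le> 0" by simp
    finally show "(\<Sum>i\<in>?I. \<Sum>j\<in>?I. \<alpha> i * \<alpha> j * (x i - x j)\<^sup>2) \<le> 0" .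
  qed
  show "\<exists>C. countable C \<and> C \<subseteq> space borel \<and> (\<forall>x\<in>space borel. \<forall>e>0. \<exists>c\<in>C. (x - c :: real)\<^sup>2 < e)"
  proof (intro exI conjI ballI allI impI)
    fix x e :: real assume "e > 0"
    then obtain c where c: "c \<in> \<rat>" "x < c" "c < x + sqrt e"
      using Rats_dense_in_real[of x "x + sqrt e"] by auto
    then have "(c - x)\<^sup>2 < (sqrt e)\<^sup>2" by (intro power_strict_mono) auto
    then show "\<exists>c\<in>\<rat>. (x - c)\<^sup>2 < e"
      using c \<open>e > 0\<close> by (intro bexI[of _ c]) (auto simp: power2_commute)
  qed (auto simp: countable_rat)
  have "kernel_open UNIV (\<lambda>x y :: real. (x - y)\<^sup>2) U" if "open U" for U
    unfolding kernel_open_def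
  proof (intro conjI ballI)
    fix x assume "x \<in> U"
    then obtain r where r: "r > 0" "ball x r \<subseteq> U" using \<open>open U\<close> by (auto simp: open_contains_ball)
    have "y \<in> U" if "(x - y)\<^sup>2 < r\<^sup>2" for y
      using r that abs_le_square_iff[of r "x - y"] by (intro subsetD[OF r(2)]) (auto simp: dist_real_def)
    then show "\<exists>r>0. \<forall>y\<in>UNIV. (x - y)\<^sup>2 < r \<longrightarrow> y \<in> U"
      using r(1) by (intro exI[of _ "r\<^sup>2"]) auto
  qed simp
  then show "sets borel \<subseteq> sigma_sets (space borel) {U. kernel_open (space borel) (\<lambda>x y :: real. (x - y)\<^sup>2) U}"
    unfolding sets_borel space_borel by (intro sigma_sets_mono') auto
  show "(\<lambda>(x, y). (x - y)\<^sup>2) \<in> borel_measurable (borel \<Otimes>\<^sub>M (borel :: real measure))"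
    by measurable
qed auto

lemma energy_kernel_eucl_dist: "energy_kernel (eucl_borel n) (\<lambda>x y. (eucl_dist n x y)\<^sup>2)"
proof -
  have "energy_kernel (eucl_borel n) (\<lambda>x y. \<Sum>j=1..n. (x j - y j)\<^sup>2)"
    unfolding eucl_borel_def by (intro energy_kernel_PiM energy_kernel_real) auto
  then show ?thesis
    by (simp add: eucl_dist_def L2_set_def sum_nonneg)
qed

text \<open>The delicate point is measurability of \<open>d\<close> for the product sigma-algebra,
  which can fail in nonseparable spaces. Here separability writes the set where \<open>d\<close> is
  less than r as a countable union of products of balls with a common centre.\<close>

lemma (in Metric_space) energy_kernel_separable:
  assumes N: "space N = M" and neg: "conditionally_negative M d"
    and sep: "separable_space mtopology" and sets: "sigma_sets M {U. openin mtopology U} = sets N"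
  shows "energy_kernel N d"
proof
  obtain C where C: "countable C" "C \<subseteq> M" "mtopology closure_of C = M"
    using sep by (auto simp: separable_space_def)
  have dense: "\<exists>c\<in>C. d x c < e" if "x \<in> M" "e > 0" for x e
    using that C(3) by (auto simp: metric_closure_of)
  show "\<exists>C. countable C \<and> C \<subseteq> space N \<and> (\<forall>x\<in>space N. \<forall>e>0. \<exists>c\<in>C. d x c < e)"
    using C dense by (auto simp: N)
  have "kernel_open M d U" if U: "openin mtopology U" for U
    unfolding kernel_open_def
  proof (intro conjI ballI)
    show UM: "U \<subseteq> M" using U by (simp add: openin_mtopology)
    fix x assume x: "x \<in> U"
    then obtain r where r: "r > 0" "mball x r \<subseteq> U"
      using U unfolding openin_mtopology by blast
    have "y \<in> U" if "y \<in> M" "d x y < r" for y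
      by (rule subsetD[OF r(2)]) (simp add: that subsetD[OF UM x])
    then show "\<exists>r>0. \<forall>y\<in>M. d x y < r \<longrightarrow> y \<in> U"
      using r(1) by blast
  qed
  then show "sets N \<subseteq> sigma_sets (space N) {U. kernel_open (space N) d U}"
    unfolding N sets[symmetric] by (intro sigma_sets_mono') auto
  have ball: "mball c r \<in> sets N" for c r
    unfolding sets[symmetric] by (intro sigma_sets.Basic) (simp add: openin_mball)
  show "case_prod d \<in> borel_measurable (N \<Otimes>\<^sub>M N)"
    unfolding borel_measurable_iff_less
  proof
    fix r :: real
    define J where "J = {(c, q, q'). c \<in> C \<and> q \<in> \<rat> \<and> q' \<in> \<rat> \<and> q + q' \<le> r}"
    have "countable J"
      by (rule countable_subset[of _ "C \<times> \<rat> \<times> \<rat>"]) (auto simp: J_def C countable_rat)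
    have "{z \<in> space (N \<Otimes>\<^sub>M N). case_prod d z < r} = (\<Union>(c, q, q')\<in>J. mball c q \<times> mball c q')"
    proof (intro equalityI subsetI)
      fix z assume "z \<in> {z \<in> space (N \<Otimes>\<^sub>M N). case_prod d z < r}"
      then obtain x y where z: "z = (x, y)" and xy: "x \<in> M" "y \<in> M" "d x y < r"
        by (auto simp: space_pair_measure N)
      \<comment> \<open>One third of the gap: \<open>q\<close> uses one e, the detour from
        \<open>c\<close> to \<open>y\<close> through \<open>x\<close> a second, and the choice of
        \<open>q'\<close> a third.\<close>
      define e where "e = (r - d x y) / 3"
      have "e > 0" using xy by (simp add: e_def)
      then obtain c where c: "c \<in> C" "d x c < e" using dense xy by blast
      then have cM: "c \<in> M" using C by auto
      obtain q where q: "q \<in> \<rat>" "d x c < q" "q < e"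
        using Rats_dense_in_real[OF c(2)] by auto
      obtain q' where q': "q' \<in> \<rat>" "d c y < q'" "q' < d c y + e"
        using Rats_dense_in_real[of "d c y" "d c y + e"] \<open>e > 0\<close> by auto
      have "d c y \<le> d c x + d x y" using triangle cM xy by blast
      moreover have "3 * e = r - d x y" by (simp add: e_def)
      ultimately have "q + q' \<le> r"
        using q q' c commute[of c x] by linarith
      then have "(c, q, q') \<in> J" using c q q' by (simp add: J_def)
      moreover have "z \<in> mball c q \<times> mball c q'"
        using z xy cM q q' by (simp add: commute)
      ultimately show "z \<in> (\<Union>(c, q, q')\<in>J. mball c q \<times> mball c q')" by blast
    next
      fix z assume "z \<in> (\<Union>(c, q, q')\<in>J. mball c q \<times> mball c q')"
      then obtain c q q' x y where z: "z = (x, y)" "q + q' \<le> r" "c \<in> M" "x \<in> M" "y \<in> M" "d c x < q" "d c y < q'"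
        by (auto simp: J_def)
      then have "d x y \<le> d c x + d c y"
        using triangle[of x c y] commute[of x c] by simp
      then show "z \<in> {z \<in> space (N \<Otimes>\<^sub>M N). case_prod d z < r}"
        using z by (simp add: space_pair_measure N)
    qed
    also have "\<dots> \<in> sets (N \<Otimes>\<^sub>M N)"
      using \<open>countable J\<close> ball by (intro sets.countable_UN'') (auto intro!: pair_measureI)
    finally show "{z \<in> space (N \<Otimes>\<^sub>M N). case_prod d z < r} \<in> sets (N \<Otimes>\<^sub>M N)" .
  qed
  fix x y z assume "x \<in> space N" "y \<in> space N" "z \<in> space N"
  then have "d x z \<le> d x y + d y z" unfolding N by (rule triangle)
  then show "d x z \<le> 2 * (d x y + d y z)"
    using nonneg[of x y] nonneg[of y z] by argo
qed (use neg in \<open>auto simp: N commute\<close>)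

lemma space_eucl_borel: "space (eucl_borel n) = eucl_space n"
  by (simp add: eucl_borel_def eucl_space_def space_PiM)

lemma energy_kernel_strong_negative_type:
  assumes "strong_negative_type (eucl_space n) \<delta>" "borel_compatible n \<delta>"
  shows "energy_kernel (eucl_borel n) \<delta>"
proof -
  have neg: "negative_type (eucl_space n) \<delta>" using assms(1) by (simp add: strong_negative_type_def)
  then interpret Metric_space "eucl_space n" \<delta> by (simp add: negative_type_def)
  show ?thesis
    using neg assms(2)
    by (intro energy_kernel_separable)
      (auto simp: space_eucl_borel negative_type_def conditionally_negative_def borel_compatible_def)
qed

text \<open>Independence turns the three joint laws into products of the marginal laws. The
  reference point \<open>c\<close> only secures integrability, which has to be checked because a
  Bochner integral that diverges is 0 by convention.\<close>

lemma (in energy_kernel) energy_distance_eq_zero_iff: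
  assumes M: "prob_space M" and XY: "prob_space.indep_var M N X N Y"
    and copy: "prob_space.indep_var M (N \<Otimes>\<^sub>M N) (\<lambda>\<omega>. (X \<omega>, Y \<omega>)) (N \<Otimes>\<^sub>M N) (\<lambda>\<omega>. (X' \<omega>, Y' \<omega>))"
      "distr M (N \<Otimes>\<^sub>M N) (\<lambda>\<omega>. (X' \<omega>, Y' \<omega>)) = distr M (N \<Otimes>\<^sub>M N) (\<lambda>\<omega>. (X \<omega>, Y \<omega>))"
    and c: "c \<in> space N" "integrable M (\<lambda>\<omega>. sqrt (\<delta> (X \<omega>) c))" "integrable M (\<lambda>\<omega>. sqrt (\<delta> (Y \<omega>) c))"
  shows "energy_distance M (\<lambda>x y. sqrt (\<delta> x y)) X Y X' Y' = 0 \<longleftrightarrow> distr M N X = distr M N Y"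
proof -
  interpret M: prob_space M by fact
  have [measurable]: "X \<in> M \<rightarrow>\<^sub>M N" "Y \<in> M \<rightarrow>\<^sub>M N"
    using M.indep_var_rv1[OF XY] M.indep_var_rv2[OF XY] by auto
  have XY'[measurable]: "(\<lambda>\<omega>. (X' \<omega>, Y' \<omega>)) \<in> M \<rightarrow>\<^sub>M N \<Otimes>\<^sub>M N"
    using M.indep_var_rv2[OF copy(1)] .
  have [measurable]: "X' \<in> M \<rightarrow>\<^sub>M N" "Y' \<in> M \<rightarrow>\<^sub>M N"
    using measurable_compose[OF XY' measurable_fst] measurable_compose[OF XY' measurable_snd] by auto
  have "distr (distr M (N \<Otimes>\<^sub>M N) (\<lambda>\<omega>. (X' \<omega>, Y' \<omega>))) N g = distr (distr M (N \<Otimes>\<^sub>M N) (\<lambda>\<omega>. (X \<omega>, Y \<omega>))) N g" for g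
    by (simp add: copy(2))
  from this[of fst] this[of snd] have law: "distr M N X' = distr M N X" "distr M N Y' = distr M N Y"
    by (simp_all add: distr_distr o_def)
  have XX': "M.indep_var N X N X'" "M.indep_var N Y N Y'"
    using M.indep_var_compose[OF copy(1) measurable_fst measurable_fst]
      M.indep_var_compose[OF copy(1) measurable_snd measurable_snd] by (simp_all add: o_def)
  have [measurable]: "(\<lambda>x. \<delta> x c) \<in> borel_measurable N" using c(1) by (rule measurable_kernel_section)
  have "integrable (distr M N X') (\<lambda>x. sqrt (\<delta> x c))" "integrable (distr M N Y') (\<lambda>x. sqrt (\<delta> x c))"
    using c unfolding law by (simp_all add: integrable_distr_eq)
  then have int': "integrable M (\<lambda>\<omega>. sqrt (\<delta> (X' \<omega>) c))" "integrable M (\<lambda>\<omega>. sqrt (\<delta> (Y' \<omega>) c))"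
    by (simp_all add: integrable_distr_eq)
  have pair: "distr M N U \<Otimes>\<^sub>M distr M N V = distr M (N \<Otimes>\<^sub>M N) (\<lambda>\<omega>. (U \<omega>, V \<omega>))" (is ?thesis1)
      "(\<integral>\<omega>. sqrt (\<delta> (U \<omega>) (V \<omega>)) \<partial>M) = (\<integral>z. sqrt (case_prod \<delta> z) \<partial>(distr M N U \<Otimes>\<^sub>M distr M N V))" (is ?thesis2)
      "integrable (distr M N U \<Otimes>\<^sub>M distr M N V) (\<lambda>z. sqrt (case_prod \<delta> z))" (is ?thesis3)
    if ind: "M.indep_var N U N V"
      and i: "integrable M (\<lambda>\<omega>. sqrt (\<delta> (U \<omega>) c))" "integrable M (\<lambda>\<omega>. sqrt (\<delta> (V \<omega>) c))" for U V
  proof -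
    have [measurable]: "U \<in> M \<rightarrow>\<^sub>M N" "V \<in> M \<rightarrow>\<^sub>M N"
      using M.indep_var_rv1[OF ind] M.indep_var_rv2[OF ind] by auto
    show *: ?thesis1 using ind by (simp add: M.indep_var_distribution_eq)
    show ?thesis2 unfolding * by (simp add: integral_distr)
    have "integrable M (\<lambda>\<omega>. sqrt (\<delta> (U \<omega>) (V \<omega>)))"
    proof (rule Bochner_Integration.integrable_bound)
      show "integrable M (\<lambda>\<omega>. 2 * (sqrt (\<delta> (U \<omega>) c) + sqrt (\<delta> (V \<omega>) c)))" using i by simp
      show "AE \<omega> in M. norm (sqrt (\<delta> (U \<omega>) (V \<omega>))) \<le> norm (2 * (sqrt (\<delta> (U \<omega>) c) + sqrt (\<delta> (V \<omega>) c)))"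
      proof (rule AE_I2)
        fix \<omega> assume "\<omega> \<in> space M"
        then have sp: "U \<omega> \<in> space N" "V \<omega> \<in> space N" by (auto intro: measurable_space)
        let ?u = "\<delta> (U \<omega>) c" and ?v = "\<delta> (V \<omega>) c"
        have uv: "0 \<le> ?u" "0 \<le> ?v" "0 \<le> \<delta> (U \<omega>) (V \<omega>)" using sp c(1) nonneg by auto
        \<comment> \<open>The aim is a triangle inequality through \<open>c\<close> for
          \<open>sqrt \<delta>\<close>, with a factor 2 to spare.\<close>
        have "\<delta> (U \<omega>) (V \<omega>) \<le> 2 * (?u + ?v)"
          using quasi_triangle[OF sp(1) c(1) sp(2)] sym[OF c(1) sp(2)] by simp
        also have "\<dots> \<le> (2 * (sqrt ?u + sqrt ?v))\<^sup>2"
          using uv by (simp add: power2_eq_square algebra_simps)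
        finally have "sqrt (\<delta> (U \<omega>) (V \<omega>)) \<le> 2 * (sqrt ?u + sqrt ?v)"
          using uv by (intro real_le_lsqrt) auto
        then show "norm (sqrt (\<delta> (U \<omega>) (V \<omega>))) \<le> norm (2 * (sqrt ?u + sqrt ?v))"
          using uv by simp
      qed
    qed measurable
    then show ?thesis3 unfolding * by (simp add: integrable_distr_eq)
  qed
  have ed: "energy_distance M (\<lambda>x y. sqrt (\<delta> x y)) X Y X' Y' =
      2 * (\<integral>z. sqrt (case_prod \<delta> z) \<partial>(distr M N X \<Otimes>\<^sub>M distr M N Y)) -
      (\<integral>z. sqrt (case_prod \<delta> z) \<partial>(distr M N X \<Otimes>\<^sub>M distr M N X)) -
      (\<integral>z. sqrt (case_prod \<delta> z) \<partial>(distr M N Y \<Otimes>\<^sub>M distr M N Y))"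
    using pair(2)[OF XY c(2,3)] pair(2)[OF XX'(1) c(2) int'(1)] pair(2)[OF XX'(2) c(3) int'(2)]
    by (simp add: energy_distance_def law)
  show ?thesis
  proof
    assume "energy_distance M (\<lambda>x y. sqrt (\<delta> x y)) X Y X' Y' = 0"
    then show "distr M N X = distr M N Y"
      using pair(3)[OF XY c(2,3)] pair(3)[OF XX'(1) c(2) int'(1)] pair(3)[OF XX'(2) c(3) int'(2)]
      by (intro energy_zero_imp_eq) (auto simp: ed law M.prob_space_distr)
  next
    assume "distr M N X = distr M N Y"
    then show "energy_distance M (\<lambda>x y. sqrt (\<delta> x y)) X Y X' Y' = 0"
      by (simp add: ed)
  qed
qed

theorem theoremA1:
  fixes M :: "'w measure"
    and p :: nat and d :: "nat \<Rightarrow> nat"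
    and \<rho> :: "nat \<Rightarrow> (nat \<Rightarrow> real) \<Rightarrow> (nat \<Rightarrow> real) \<Rightarrow> real"
    and X Y X' Y' :: "'w \<Rightarrow> nat \<Rightarrow> nat \<Rightarrow> real"
  defines "B \<equiv> grouped_borel p d"
  assumes "prob_space M"
    and "p \<ge> 1" and "\<And>i. i \<in> {1..p} \<Longrightarrow> d i \<ge> 1"
    and XY_indep: "prob_space.indep_var M B X B Y"
    and copy_indep: "prob_space.indep_var M
          (B \<Otimes>\<^sub>M B) (\<lambda>\<omega>. (X \<omega>, Y \<omega>)) (B \<Otimes>\<^sub>M B) (\<lambda>\<omega>. (X' \<omega>, Y' \<omega>))"
    and copy_distr: "distr M (B \<Otimes>\<^sub>M B) (\<lambda>\<omega>. (X' \<omega>, Y' \<omega>)) = distr M (B \<Otimes>\<^sub>M B) (\<lambda>\<omega>. (X \<omega>, Y \<omega>))"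
    and cases_S1_S2:
      "(\<forall>i\<in>{1..p}. strong_negative_type (eucl_space (d i)) (\<rho> i) \<and> borel_compatible (d i) (\<rho> i)) \<or>
       (\<forall>i\<in>{1..p}. \<forall>x\<in>eucl_space (d i). \<forall>y\<in>eucl_space (d i). \<rho> i x y = (eucl_dist (d i) x y)\<^sup>2)"
    and moment_X: "(SUP i\<in>{1..p}. \<integral>\<^sup>+\<omega>. ennreal (sqrt (\<rho> i (X \<omega> i) (eucl_origin (d i)))) \<partial>M) < \<infinity>"
    and moment_Y: "(SUP i\<in>{1..p}. \<integral>\<^sup>+\<omega>. ennreal (sqrt (\<rho> i (Y \<omega> i) (eucl_origin (d i)))) \<partial>M) < \<infinity>"
  shows "energy_distance M (group_metric p \<rho>) X Y X' Y' = 0 \<longleftrightarrow> distr M B X = distr M B Y"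
proof -
  interpret M: prob_space M by fact
  have kernel: "energy_kernel (eucl_borel (d i)) (\<rho> i)" if i: "i \<in> {1..p}" for i
    using cases_S1_S2
  proof
    assume "\<forall>i\<in>{1..p}. strong_negative_type (eucl_space (d i)) (\<rho> i) \<and> borel_compatible (d i) (\<rho> i)"
    then show ?thesis using i by (intro energy_kernel_strong_negative_type) auto
  next
    assume "\<forall>i\<in>{1..p}. \<forall>x\<in>eucl_space (d i). \<forall>y\<in>eucl_space (d i). \<rho> i x y = (eucl_dist (d i) x y)\<^sup>2"
    then show ?thesis
      using i by (intro energy_kernel_cong[OF energy_kernel_eucl_dist]) (simp add: space_eucl_borel)
  qed
  define D where "D x y = (\<Sum>i=1..p. \<rho> i (x i) (y i))" for x y
  \<comment> \<open>From here on the cases S1 and S2 are no longer distinguished.\<close>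
  interpret energy_kernel B D
    unfolding B_def grouped_borel_def D_def by (intro energy_kernel_PiM kernel) auto
  define c where "c = (\<lambda>i\<in>{1..p}. eucl_origin (d i))"
  have origin: "eucl_origin n \<in> space (eucl_borel n)" for n
    by (auto simp: eucl_origin_def eucl_borel_def space_PiM)
  then have c: "c \<in> space B"
    by (auto simp: c_def B_def grouped_borel_def space_PiM)
  have integrable: "integrable M (\<lambda>\<omega>. sqrt (D (U \<omega>) c))"
    if U: "U \<in> M \<rightarrow>\<^sub>M B"
      and moment: "(SUP i\<in>{1..p}. \<integral>\<^sup>+\<omega>. ennreal (sqrt (\<rho> i (U \<omega> i) (eucl_origin (d i)))) \<partial>M) < \<infinity>" for U
  proof (rule Bochner_Integration.integrable_bound)
    have Ui: "(\<lambda>\<omega>. U \<omega> i) \<in> M \<rightarrow>\<^sub>M eucl_borel (d i)" if "i \<in> {1..p}" for i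
      using measurable_compose[OF U[unfolded B_def grouped_borel_def] measurable_component_singleton[OF that]] .
    have nn: "0 \<le> \<rho> i (U \<omega> i) (eucl_origin (d i))" if "i \<in> {1..p}" "\<omega> \<in> space M" for i \<omega>
      using energy_kernel.nonneg[OF kernel] measurable_space[OF Ui] origin that by blast
    have "integrable M (\<lambda>\<omega>. sqrt (\<rho> i (U \<omega> i) (eucl_origin (d i))))" if i: "i \<in> {1..p}" for i
    proof (rule integrableI_nonneg)
      have "(\<lambda>\<omega>. \<rho> i (U \<omega> i) (eucl_origin (d i))) \<in> borel_measurable M"
        using measurable_compose[OF Ui energy_kernel.measurable_kernel_section[OF kernel origin]] i by simp
      then show "(\<lambda>\<omega>. sqrt (\<rho> i (U \<omega> i) (eucl_origin (d i)))) \<in> borel_measurable M"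
        by measurable
      show "(\<integral>\<^sup>+\<omega>. ennreal (sqrt (\<rho> i (U \<omega> i) (eucl_origin (d i)))) \<partial>M) < \<infinity>"
        by (rule le_less_trans[OF SUP_upper moment]) (rule i)
    qed (use nn i in auto)
    then show "integrable M (\<lambda>\<omega>. \<Sum>i=1..p. sqrt (\<rho> i (U \<omega> i) (eucl_origin (d i))))"
      by (rule Bochner_Integration.integrable_sum)
    show "AE \<omega> in M. norm (sqrt (D (U \<omega>) c)) \<le> norm (\<Sum>i=1..p. sqrt (\<rho> i (U \<omega> i) (eucl_origin (d i))))"
    proof (rule AE_I2)
      fix \<omega> assume \<omega>: "\<omega> \<in> space M"
      \<comment> \<open>The root of a sum of squares is at most the sum of the absolute values, so
        the moments of the single groups suffice.\<close>
      have "sqrt (D (U \<omega>) c) = L2_set (\<lambda>i. sqrt (\<rho> i (U \<omega> i) (eucl_origin (d i)))) {1..p}"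
        using nn \<omega> by (auto simp: D_def L2_set_def c_def intro!: sum.cong)
      also have "\<dots> \<le> (\<Sum>i=1..p. sqrt (\<rho> i (U \<omega> i) (eucl_origin (d i))))"
        using nn \<omega> by (intro L2_set_le_sum) auto
      finally show "norm (sqrt (D (U \<omega>) c)) \<le> norm (\<Sum>i=1..p. sqrt (\<rho> i (U \<omega> i) (eucl_origin (d i))))"
        using nonneg[OF measurable_space[OF U \<omega>] c] by simp
    qed
    show "(\<lambda>\<omega>. sqrt (D (U \<omega>) c)) \<in> borel_measurable M"
      using measurable_compose[OF U measurable_kernel_section[OF c]] by measurable
  qed
  have "energy_distance M (\<lambda>x y. sqrt (D x y)) X Y X' Y' = 0 \<longleftrightarrow> distr M B X = distr M B Y"
    by (rule energy_distance_eq_zero_iff[OF M.prob_space_axioms XY_indep copy_indep copy_distr c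
          integrable[OF M.indep_var_rv1[OF XY_indep] moment_X]
          integrable[OF M.indep_var_rv2[OF XY_indep] moment_Y]])
  moreover have "group_metric p \<rho> = (\<lambda>x y. sqrt (D x y))"
    by (simp add: group_metric_def D_def fun_eq_iff)
  ultimately show ?thesis by simp
qed

end
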